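(* Consider the stochastic optimization problem $\min_{x\in\mathbb{R}^n} f(x)$, $f(x):=\mathsf{E}[F(x,\xi)]$, and let $\{x_k\}$ be generated by the cyclic regularized stochastic quasi-Newton algorithm described in the context. Assume: (A1) $F(\cdot,\xi)$ is convex for every realization of $\xi$; $f$ is continuously differentiable on $\mathbb{R}^n$ with gradient Lipschitz continuous with parameter $L>0$; the optimal solution set of the problem is nonempty. (A2) The random variables $\xi_k$, $k\ge 0$, are i.i.d. (with the law of $\xi$); $\mathsf{E}[\nabla F(x,\xi)]=\nabla f(x)$ for all $x\in\mathbb{R}^n$; and there is $\nu>0$ such that $\mathsf{E}[\|\nabla F(x,\xi)-\nabla f(x)\|^2]\le \nu^2$ for all $x\in\mathbb{R}^n$. (A3) The sequences $\{\gamma_k\},\{\mu_k\},\{\delta_k\}$ of positive scalars satisfy: (a) $\lim_{k\to\infty}\frac{\gamma_k}{\mu_k^3\delta_k}=0$; (b) $\delta_k\mu_{k-1}\le 1$ for $k\ge 1$; (c) $\mu_{k+1}=\mu_k$ if $k$ is even, $\mu_{k+1}<\mu_k$ if $k$ is odd, and $\mu_k\to 0$; (d) $\sum_{k=0}^\infty \gamma_k\delta_k\mu_k=\infty$; (e) $\sum_{k=0}^\infty (\gamma_k/\mu_k)^2<\infty$; (f) $\sum_{k=0}^\infty \gamma_k\delta_k\mu_k^2<\infty$; (g) $\gamma_k\delta_k\mu_k\le 1$ for $k\ge 0$. Then $\lim_{k\to\infty} f(x_k)=f^*$ almost surely, where $f^*$ is the optimal value of the problem.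
   Context: Setting: $(\Omega,\mathcal{F},\mathbb{P})$ is a probability space, $\xi:\Omega\to\mathbb{R}^d$ is a random vector, $F:\mathbb{R}^n\times\mathbb{R}^d\to\mathbb{R}$ is measurable and differentiable in its first argument; $\nabla F(x,\xi)$ denotes the gradient with respect to $x$. $\|\cdot\|$ is the Euclidean norm, $\mathbf{I}$ the identity matrix, and $A\succeq C$ means $A-C$ is positive semidefinite. Algorithm (CR-SQN): given an initial (possibly random, independent of $\{\xi_k\}$) point $x_0\in\mathbb{R}^n$, samples $\xi_0,\xi_1,\dots$, deterministic positive sequences $\{\gamma_k\}$ (stepsizes), $\{\delta_k\}$, $\{\mu_k\}$ (regularization parameters), a constant $0<\rho<1$, and a symmetric matrix $B_0\succeq\rho\mu_0\mathbf{I}$, for $k\ge 0$ set $$x_{k+1}:=x_k-\gamma_k\left(B_k^{-1}+\delta_k\mathbf{I}\right)\left(\nabla F(x_k,\xi_k)+\mu_kx_k\right).$$ The sequence $\mu_k$ satisfies $\mu_{k+1}=\mu_k$ for even $k$ and $\mu_{k+1}<\mu_k$ for odd $k$. The matrices are updated by $$B_{k+1}:=\begin{cases} B_k-\dfrac{B_ks_ks_k^TB_k}{s_k^TB_ks_k}+\dfrac{y_k^B(y_k^B)^T}{s_k^Ty_k^B}+\rho\mu_k\mathbf{I}, & k\text{ even},\\ B_k, & k\text{ odd},\end{cases}$$ where for even $k$: $s_k:=x_{k+1}-x_k$ and $y_k^B:=\nabla F(x_{k+1},\xi_k)-\nabla F(x_k,\xi_k)+(1-\rho)\mu_ks_k$.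 Standing assumption: for every even $k$, $\nabla F(x_k,\xi_k)+\mu_kx_k\ne 0$ along the generated sequence. *)

theory Defs
  imports "HOL-Probability.Probability"
begin

(* The Riesz representative of the derivative; unspecified where f is not differentiable. *)
definition grad :: "('a::real_inner \<Rightarrow> real) \<Rightarrow> 'a \<Rightarrow> 'a" where
  "grad f x = (THE D. GDERIV f x :> D)"

lemma grad_eqI:
  assumes D: "GDERIV f x :> D"
  shows "grad f x = D"
  unfolding grad_def
proof (rule the_equality)
  show "GDERIV f x :> D"
    by (rule D)
next
  fix D' assume "GDERIV f x :> D'"
  then have "(\<lambda>h. h \<bullet> D') = (\<lambda>h. h \<bullet> D)"
    using D unfolding gderiv_def by (rule has_derivative_unique)
  then have "(D' - D) \<bullet> D' = (D' - D) \<bullet> D"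
    by (rule fun_cong)
  then have "(D' - D) \<bullet> (D' - D) = 0"
    by (simp only: inner_diff_right)
  then show "D' = D"
    by (simp only: inner_eq_zero_iff right_minus_eq)
qed

lemma GDERIV_grad:
  fixes f :: "'a::euclidean_space \<Rightarrow> real"
  assumes "f differentiable (at x)"
  shows "GDERIV f x :> grad f x"
proof -
  obtain f' where f': "(f has_derivative f') (at x)"
    using assms unfolding differentiable_def by (elim exE)
  have lin: "linear f'"
    using f' by (rule has_derivative_linear)
  have "f' = (\<lambda>h. h \<bullet> adjoint f' 1)"
    by (rule ext) (simp add: adjoint_works[OF lin])
  with f' have D: "GDERIV f x :> adjoint f' 1"
    unfolding gderiv_def by (simp only:)
  show ?thesis
    unfolding grad_eqI[OF D] by (rule D)
qed

definition outer :: "real ^ 'n \<Rightarrow> real ^ 'n \<Rightarrow> real ^ 'n ^ 'n" where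
  "outer u v = (columnvector u :: real ^ 1 ^ 'n) ** (rowvector v :: real ^ 'n ^ 1)"

definition psd :: "real ^ 'n ^ 'n \<Rightarrow> bool" where
  "psd A \<longleftrightarrow> transpose A = A \<and> (\<forall>v. 0 \<le> v \<bullet> (A *v v))"

definition loewner_ge :: "real ^ 'n ^ 'n \<Rightarrow> real ^ 'n ^ 'n \<Rightarrow> bool" where
  "loewner_ge A C \<longleftrightarrow> psd (A - C)"

definition qn_y ::
  "(real ^ 'n \<Rightarrow> real ^ 'd \<Rightarrow> real) \<Rightarrow> real \<Rightarrow> real \<Rightarrow> real ^ 'd \<Rightarrow> real ^ 'n \<Rightarrow> real ^ 'n \<Rightarrow> real ^ 'n" where
  "qn_y F \<rho> m z x x' =
     grad (\<lambda>u. F u z) x' - grad (\<lambda>u. F u z) x + ((1 - \<rho>) * m) *\<^sub>R (x' - x)"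

definition qn_update :: "real \<Rightarrow> real ^ 'n ^ 'n \<Rightarrow> real ^ 'n \<Rightarrow> real ^ 'n \<Rightarrow> real ^ 'n ^ 'n" where
  "qn_update c B s y =
     B - (1 / (s \<bullet> (B *v s))) *\<^sub>R (B ** outer s s ** B)
       + (1 / (s \<bullet> y)) *\<^sub>R outer y y + c *\<^sub>R mat 1"

(* x and B form one trajectory of the algorithm for the sample sequence z;
   the starting point x 0 is left free. *)
definition cr_sqn ::
  "(real ^ 'n \<Rightarrow> real ^ 'd \<Rightarrow> real) \<Rightarrow> (nat \<Rightarrow> real) \<Rightarrow> (nat \<Rightarrow> real) \<Rightarrow> (nat \<Rightarrow> real) \<Rightarrow> real \<Rightarrow>
   real ^ 'n ^ 'n \<Rightarrow> (nat \<Rightarrow> real ^ 'd) \<Rightarrow> (nat \<Rightarrow> real ^ 'n) \<Rightarrow> (nat \<Rightarrow> real ^ 'n ^ 'n) \<Rightarrow> bool" where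
  "cr_sqn F \<gamma> \<delta> \<mu> \<rho> B0 z x B \<longleftrightarrow>
     B 0 = B0 \<and>
     (\<forall>k. x (Suc k) = x k - \<gamma> k *\<^sub>R
        ((matrix_inv (B k) + \<delta> k *\<^sub>R mat 1) *v (grad (\<lambda>u. F u (z k)) (x k) + \<mu> k *\<^sub>R x k))) \<and>
     (\<forall>k. B (Suc k) =
        (if even k
         then qn_update (\<rho> * \<mu> k) (B k) (x (Suc k) - x k) (qn_y F \<rho> (\<mu> k) (z k) (x k) (x (Suc k)))
         else B k))"

end

theory Submission
  imports Defs
begin

text \<open>
  The rank-two update keeps \<open>B\<^sub>k \<succeq> \<rho>\<mu>\<^sub>k I\<close>, because \<open>s\<^sub>k\<^sup>T y\<^sub>k \<ge> 0\<close> by monotonicity of the gradient of a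
  convex function; hence \<open>B\<^sub>k\<^sup>-\<^sup>1 + \<delta>\<^sub>k I\<close> has its spectrum in \<open>[\<delta>\<^sub>k, C/\<mu>\<^sub>k]\<close>. Put
  \<open>e\<^sub>k = f(x\<^sub>k) - f\<^sup>* + \<mu>\<^sub>k/2 \<parallel>x\<^sub>k\<parallel>\<^sup>2\<close>. The descent lemma and strong convexity of the regularized
  objective give, for large \<open>k\<close>, a conditional drift
  \<open>E e\<^sub>k\<^sub>+\<^sub>1 \<le> (1 - \<gamma>\<^sub>k\<delta>\<^sub>k\<mu>\<^sub>k) e\<^sub>k + b\<^sub>k\<close> with \<open>\<Sum> b\<^sub>k < \<infinity>\<close> and \<open>\<Sum> \<gamma>\<^sub>k\<delta>\<^sub>k\<mu>\<^sub>k = \<infinity>\<close>. So the mean of \<open>e\<^sub>k\<close> tends to \<open>0\<close>, and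
  a maximal inequality for the nonnegative supermartingale \<open>e\<^sub>k + \<Sum>\<^sub>i\<^sub>\<ge>\<^sub>k b\<^sub>i\<close> turns this into almost
  sure convergence. No filtration is needed: \<open>(x\<^sub>k, B\<^sub>k)\<close> is a recursion driven by an i.i.d. sequence,
  so one conditions on the first step, for a deterministic starting point. A random \<open>x\<^sub>0\<close>, which
  need not have moments, is reached by Fubini's theorem at the end.
\<close>

subsection \<open>Stochastic recursions with contracting drift\<close>

text \<open>Adding the tail of the series of \<open>b\<close> to \<open>v\<close> gives a
  nonincreasing sequence, so \<open>v\<close> converges. The decrements dominate
  \<open>a m * v m\<close> and telescope, so that series converges; a positive limit of
  \<open>v\<close> would then make \<open>a\<close> summable.\<close>

lemma contracting_recursion_tendsto_0:
  fixes v a b :: "nat \<Rightarrow> real"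
  assumes v0: "\<And>m. 0 \<le> v m"
    and rec: "\<And>m. v (Suc m) \<le> (1 - a m) * v m + b m"
    and a: "\<And>m. 0 \<le> a m" and b: "\<And>m. 0 \<le> b m" "summable b"
    and div: "\<not> summable a"
  shows "v \<longlonglongrightarrow> 0"
proof -
  define t where "t m = (\<Sum>i. b (i + m))" for m
  have sb: "summable (\<lambda>i. b (i + m))" for m
    using b(2) by (simp add: summable_iff_shift)
  have t0: "0 \<le> t m" for m
    unfolding t_def using b sb by (intro suminf_nonneg) auto
  have t_Suc: "t m = b m + t (Suc m)" for m
    unfolding t_def using suminf_split_head[OF sb[of m]] by simp
  have t_lim: "t \<longlonglongrightarrow> 0"
    unfolding t_def using suminf_exist_split2[OF b(2)] by simp
  have step: "v (Suc m) + t (Suc m) \<le> v m + t m - a m * v m" for m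
    using rec[of m] t_Suc[of m] by (simp add: algebra_simps)
  have "decseq (\<lambda>m. v m + t m)"
    unfolding decseq_Suc_iff
  proof
    fix m have "0 \<le> a m * v m" using a v0 by simp
    with step[of m] show "v (Suc m) + t (Suc m) \<le> v m + t m" by linarith
  qed
  then obtain l where l: "(\<lambda>m. v m + t m) \<longlonglongrightarrow> l"
    using decseq_convergent[of "\<lambda>m. v m + t m" 0] v0 t0 by (metis add_nonneg_nonneg)
  have vl: "v \<longlonglongrightarrow> l"
    using tendsto_diff[OF l t_lim] by simp
  have l0: "0 \<le> l" using vl v0 by (intro LIMSEQ_le_const) auto
  have sav: "summable (\<lambda>m. a m * v m)"
  proof (rule summable_comparison_test)
    have "(\<lambda>m. (v m + t m) - (v (Suc m) + t (Suc m))) sums ((v 0 + t 0) - l)"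
      by (rule telescope_sums'[OF l])
    then show "summable (\<lambda>m. (v m + t m) - (v (Suc m) + t (Suc m)))"
      by (rule sums_summable)
    show "\<exists>N. \<forall>n\<ge>N. norm (a n * v n) \<le> v n + t n - (v (Suc n) + t (Suc n))"
      using step a v0 by (auto simp: algebra_simps)
  qed
  have "l = 0"
  proof (rule ccontr)
    assume "l \<noteq> 0"
    then have "eventually (\<lambda>m. l / 2 < v m) sequentially"
      using l0 by (intro order_tendstoD(1)[OF vl]) auto
    then obtain m0 where m0: "\<And>m. m \<ge> m0 \<Longrightarrow> l / 2 < v m"
      by (auto simp: eventually_sequentially)
    have "summable (\<lambda>m. a m * (l / 2))"
    proof (rule summable_comparison_test[OF _ sav], intro exI allI impI)
      fix n assume "m0 \<le> n"
      have "a n * (l / 2) \<le> a n * v n"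
        using m0[OF \<open>m0 \<le> n\<close>] a[of n] by (intro mult_left_mono) auto
      then show "norm (a n * (l / 2)) \<le> a n * v n"
        using a[of n] l0 by simp
    qed
    then have "summable a"
      using \<open>l \<noteq> 0\<close> summable_mult2[of "\<lambda>m. a m * (l / 2)" "2 / l"] by simp
    with div show False by contradiction
  qed
  with vl show ?thesis by simp
qed

text \<open>\<open>k\<close> is the starting time and \<open>j\<close> counts steps from it. The
  noise is indexed from the start, so that dropping its first entry gives a trajectory of the same
  kind, started at \<open>Suc k\<close>.\<close>

primrec trajectory :: "(nat \<Rightarrow> 's \<Rightarrow> 'y \<Rightarrow> 's) \<Rightarrow> nat \<Rightarrow> 's \<Rightarrow> (nat \<Rightarrow> 'y) \<Rightarrow> nat \<Rightarrow> 's" where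
  "trajectory \<phi> k s z 0 = s"
| "trajectory \<phi> k s z (Suc j) = \<phi> (k + j) (trajectory \<phi> k s z j) (z j)"

text \<open>Pathwise form of the Markov property; with the invariance of \<open>S\<close> under
  prepending a fresh entry it replaces conditional expectations.\<close>

lemma trajectory_case_nat:
  "trajectory \<phi> k s (case_nat y z) (Suc j) = trajectory \<phi> (Suc k) (\<phi> k s y) z j"
  by (induction j) auto

text \<open>\<open>sequence_space\<close> provides \<open>S\<close>, the law of an i.i.d. sequence
  with marginal \<open>D\<close>, and the fact that an independent entry put in front gives
  \<open>S\<close> again.\<close>

locale stochastic_recursion = sequence_space D for D :: "'y measure" +
  fixes N :: "'s measure" and \<phi> :: "nat \<Rightarrow> 's \<Rightarrow> 'y \<Rightarrow> 's"
  assumes step_measurable: "\<And>k. (\<lambda>(s, y). \<phi> k s y) \<in> N \<Otimes>\<^sub>M D \<rightarrow>\<^sub>M N"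
begin

lemma step_measurable' [measurable]:
  assumes "g \<in> A \<rightarrow>\<^sub>M N" "h \<in> A \<rightarrow>\<^sub>M D"
  shows "(\<lambda>x. \<phi> k (g x) (h x)) \<in> A \<rightarrow>\<^sub>M N"
  using measurable_compose[OF measurable_Pair[OF assms] step_measurable[of k]] by simp

lemma trajectory_measurable:
  assumes [measurable]: "g \<in> A \<rightarrow>\<^sub>M N" "h \<in> A \<rightarrow>\<^sub>M S"
  shows "(\<lambda>x. trajectory \<phi> k (g x) (h x) j) \<in> A \<rightarrow>\<^sub>M N"
proof (induction j)
  case (Suc j)
  note Suc.IH [measurable]
  show ?case by simp
qed simp

lemma trajectory_measurable_seq [measurable]:
  "s \<in> space N \<Longrightarrow> (\<lambda>z. trajectory \<phi> k s z j) \<in> S \<rightarrow>\<^sub>M N"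
  by (intro trajectory_measurable) auto

text \<open>Fubini: \<open>S\<close> is the image of the product of \<open>D\<close> and
  \<open>S\<close> under \<open>case_nat\<close>, so a probability is the average, over the head, of
  the probabilities of the slices.\<close>

lemma
  assumes [measurable]: "Measurable.pred S P"
  shows emeasure_first_step: "emeasure S {z \<in> space S. P z} =
      (\<integral>\<^sup>+ y. emeasure S {z \<in> space S. P (case_nat y z)} \<partial>D)" (is ?eq)
    and emeasure_first_step_measurable:
      "(\<lambda>y. emeasure S {z \<in> space S. P (case_nat y z)}) \<in> borel_measurable D" (is ?meas)
proof -
  interpret PS: pair_prob_space D S ..
  let ?Q = "(\<lambda>(s, \<omega>). case_nat s \<omega>) -` {z \<in> space S. P z} \<inter> space (D \<Otimes>\<^sub>M S)"
  have Q: "?Q \<in> sets (D \<Otimes>\<^sub>M S)"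
    by (auto intro!: measurable_sets)
  have slice: "Pair y -` ?Q = {z \<in> space S. P (case_nat y z)}" if "y \<in> space D" for y
    using that by (auto simp: space_pair_measure space_PiM PiE_iff split: nat.split)
  have "emeasure S {z \<in> space S. P z} =
      emeasure (distr (D \<Otimes>\<^sub>M S) S (\<lambda>(s, \<omega>). case_nat s \<omega>)) {z \<in> space S. P z}"
    by (simp add: PiM_iter)
  also have "\<dots> = emeasure (D \<Otimes>\<^sub>M S) ?Q"
    by (rule emeasure_distr) auto
  also have "\<dots> = (\<integral>\<^sup>+ y. emeasure S (Pair y -` ?Q) \<partial>D)"
    by (rule P.emeasure_pair_measure_alt[OF Q])
  also have "\<dots> = (\<integral>\<^sup>+ y. emeasure S {z \<in> space S. P (case_nat y z)} \<partial>D)"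
    by (intro nn_integral_cong arg_cong[where f="emeasure S"] slice)
  finally show ?eq .
  show ?meas
    using P.measurable_emeasure_Pair[OF Q] slice
    by (subst (asm) measurable_cong[of D]) (auto intro!: arg_cong[where f="emeasure S"])
qed

end

text \<open>\<open>G\<close> is an almost surely preserved region in which the drift inequality is
  available from time \<open>K\<close> on. Given the state only the fresh sample is random, so the
  conditional mean is an integral over \<open>D\<close>; with a nonnegative integral the inequality
  itself asserts that this mean is finite.\<close>

locale drift_recursion = stochastic_recursion D N \<phi> for D :: "'y measure" and N :: "'s measure" and \<phi> +
  fixes G :: "nat \<Rightarrow> 's \<Rightarrow> bool" and V :: "nat \<Rightarrow> 's \<Rightarrow> real"
    and a b :: "nat \<Rightarrow> real" and K :: nat
  assumes V_measurable [measurable]: "\<And>k. V k \<in> borel_measurable N"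
    and G_space: "\<And>k s. G k s \<Longrightarrow> s \<in> space N"
    and G_step: "\<And>k s. G k s \<Longrightarrow> AE y in D. G (Suc k) (\<phi> k s y)"
    and V_nonneg: "\<And>k s. 0 \<le> V k s"
    and a: "\<And>k. 0 \<le> a k" "\<And>k. a k \<le> 1" "\<not> summable a"
    and b: "\<And>k. 0 \<le> b k" "summable b"
    and drift: "\<And>k s. K \<le> k \<Longrightarrow> G k s \<Longrightarrow>
      (\<integral>\<^sup>+ y. ennreal (V (Suc k) (\<phi> k s y)) \<partial>D) \<le> ennreal ((1 - a k) * V k s + b k)"
begin

text \<open>Backward recursion: the bound for the mean of \<open>V\<close> at time \<open>k + m\<close>, as an affine
  function of the value \<open>v\<close> of \<open>V\<close> at time \<open>k\<close>.\<close>

primrec mean_bound :: "nat \<Rightarrow> nat \<Rightarrow> real \<Rightarrow> real" where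
  "mean_bound k 0 v = v"
| "mean_bound k (Suc m) v = mean_bound (Suc k) m ((1 - a k) * v + b k)"

text \<open>The slope is a product of factors \<open>1 - a i\<close>, nonnegative because
  \<open>a i \<le> 1\<close>. Affinity with nonnegative coefficients allows taking a mean inside
  \<open>mean_bound\<close> and then applying the drift inequality.\<close>

lemma mean_bound_affine:
  obtains p q where "0 \<le> p" "0 \<le> q" "\<And>v. mean_bound k m v = p * v + q"
proof -
  have "\<exists>p q. 0 \<le> p \<and> 0 \<le> q \<and> (\<forall>v. mean_bound k m v = p * v + q)"
  proof (induction m arbitrary: k)
    case 0
    have "0 \<le> (1::real) \<and> 0 \<le> (0::real) \<and> (\<forall>v. mean_bound k 0 v = 1 * v + 0)" by simp
    then show ?case by blast
  next
    case (Suc m)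
    then obtain p q where pq: "0 \<le> p" "0 \<le> q" "\<And>v. mean_bound (Suc k) m v = p * v + q"
      by blast
    have "\<forall>v. mean_bound k (Suc m) v = (p * (1 - a k)) * v + (p * b k + q)"
      by (simp add: pq(3) algebra_simps)
    moreover have "0 \<le> p * (1 - a k)" "0 \<le> p * b k + q"
      using pq a b by auto
    ultimately show ?case by blast
  qed
  then show thesis using that by blast
qed

text \<open>The definition peels off the first step, as conditioning does; the limit in
  \<open>m\<close> needs the last step peeled off.\<close>

lemma mean_bound_Suc: "mean_bound k (Suc m) v = (1 - a (k + m)) * mean_bound k m v + b (k + m)"
proof (induction m arbitrary: k v)
  case (Suc m)
  have "mean_bound k (Suc (Suc m)) v = mean_bound (Suc k) (Suc m) ((1 - a k) * v + b k)" by simp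
  also note Suc.IH
  finally show ?case by simp
qed simp

lemma mean_bound_nonneg: "0 \<le> v \<Longrightarrow> 0 \<le> mean_bound k m v"
  by (rule mean_bound_affine[of k m]) auto

lemma mean_bound_tendsto_0:
  assumes "0 \<le> v" shows "(\<lambda>m. mean_bound k m v) \<longlonglongrightarrow> 0"
proof (rule contracting_recursion_tendsto_0)
  show "mean_bound k (Suc m) v \<le> (1 - a (k + m)) * mean_bound k m v + b (k + m)" for m
    by (simp add: mean_bound_Suc del: mean_bound.simps)
  show "summable (\<lambda>m. b (k + m))" "\<not> summable (\<lambda>m. a (k + m))"
    using a(3) b(2) summable_iff_shift[of a k] summable_iff_shift[of b k]
    by (simp_all add: add.commute)
qed (auto simp: mean_bound_nonneg assms a b)

lemma tail_nonneg: "0 \<le> (\<Sum>i. b (i + m))"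
  using b summable_iff_shift[of b m] by (intro suminf_nonneg) auto

lemma tail_Suc: "(\<Sum>i. b (i + m)) = b m + (\<Sum>i. b (i + Suc m))"
  using suminf_split_head[of "\<lambda>i. b (i + m)"] b summable_iff_shift[of b m] by simp

text \<open>Doob's maximal inequality for the supermartingale formed by \<open>V\<close> plus the tail of the series
  of \<open>b\<close>, proved by conditioning on the first step.\<close>

lemma maximal_inequality:
  assumes "0 < \<epsilon>" "K \<le> k" "G k s"
  shows "ennreal \<epsilon> * emeasure S {z \<in> space S. \<exists>j\<in>{m..m+n}. \<epsilon> \<le> V (k + j) (trajectory \<phi> k s z j)}
    \<le> ennreal (mean_bound k m (V k s) + (\<Sum>i. b (i + (k + m))))"
  using assms(2,3)
\<comment> \<open>Induction on the end of the time window with \<open>k\<close> and \<open>s\<close>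
  free: conditioning on the first step moves the start to \<open>Suc k\<close> and brings the end
  one step nearer.\<close>
proof (induction "m + n" arbitrary: m n k s)
  case 0
  have s [measurable]: "s \<in> space N" using 0 G_space by blast
  show ?case
  proof (cases "\<epsilon> \<le> V k s")
    case True
    have "ennreal \<epsilon> \<le> ennreal (V k s + (\<Sum>i. b (i + k)))"
      using True tail_nonneg[of k] by (intro ennreal_leI) auto
    then show ?thesis using 0 True P.emeasure_space_1 by simp
  qed (use 0 in auto)
next
  case (Suc r)
  have s [measurable]: "s \<in> space N" using Suc.prems G_space by blast
  let ?E = "\<lambda>m n k s. {z \<in> space S. \<exists>j\<in>{m..m+n}. \<epsilon> \<le> V (k + j) (trajectory \<phi> k s z j)}"
  \<comment> \<open>A window that omits the present time. After the first step the induction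
    hypothesis gives a bound affine in the next value of \<open>V\<close>, and the drift inequality
    bounds the mean of that value.\<close>
  have step: "ennreal \<epsilon> * emeasure S {z \<in> space S. \<exists>j\<in>{Suc m'..Suc m'+n'}.
        \<epsilon> \<le> V (k + j) (trajectory \<phi> k s z j)}
      \<le> ennreal (mean_bound (Suc k) m' ((1 - a k) * V k s + b k) + (\<Sum>i. b (i + (Suc k + m'))))"
    if "m' + n' = r" for m' n'
  proof -
    obtain p q where pq: "0 \<le> p" "0 \<le> q" "\<And>v. mean_bound (Suc k) m' v = p * v + q"
      using mean_bound_affine by blast
    let ?t = "\<Sum>i. b (i + (Suc k + m'))"
    have t: "0 \<le> ?t" by (rule tail_nonneg)
    have shift: "(\<exists>j\<in>{Suc m'..Suc m'+n'}. \<epsilon> \<le> V (k + j) (trajectory \<phi> k s (case_nat y z) j)) \<longleftrightarrow>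
        (\<exists>j\<in>{m'..m'+n'}. \<epsilon> \<le> V (Suc k + j) (trajectory \<phi> (Suc k) (\<phi> k s y) z j))" for y z
    proof -
      have *: "\<epsilon> \<le> V (k + Suc j) (trajectory \<phi> k s (case_nat y z) (Suc j)) \<longleftrightarrow>
          \<epsilon> \<le> V (Suc k + j) (trajectory \<phi> (Suc k) (\<phi> k s y) z j)" for j
        by (simp add: trajectory_case_nat del: trajectory.simps)
      have "(\<exists>j\<in>{Suc m'..Suc m'+n'}. \<epsilon> \<le> V (k + j) (trajectory \<phi> k s (case_nat y z) j)) \<longleftrightarrow>
        (\<exists>j\<in>Suc ` {m'..m'+n'}. \<epsilon> \<le> V (k + j) (trajectory \<phi> k s (case_nat y z) j))"
        by (simp add: image_Suc_atLeastAtMost del: trajectory.simps)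
      also have "\<dots> \<longleftrightarrow> (\<exists>j\<in>{m'..m'+n'}.
          \<epsilon> \<le> V (Suc k + j) (trajectory \<phi> (Suc k) (\<phi> k s y) z j))"
        by (simp only: Set.bex_simps *)
      finally show "(\<exists>j\<in>{Suc m'..Suc m'+n'}. \<epsilon> \<le> V (k + j) (trajectory \<phi> k s (case_nat y z) j)) \<longleftrightarrow>
        (\<exists>j\<in>{m'..m'+n'}. \<epsilon> \<le> V (Suc k + j) (trajectory \<phi> (Suc k) (\<phi> k s y) z j))" .
    qed
    have meas: "(\<lambda>y. emeasure S (?E m' n' (Suc k) (\<phi> k s y))) \<in> borel_measurable D"
      using emeasure_first_step_measurable[of "\<lambda>z. \<exists>j\<in>{Suc m'..Suc m'+n'}.
        \<epsilon> \<le> V (k + j) (trajectory \<phi> k s z j)"]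
      unfolding shift by simp
    have "emeasure S {z \<in> space S. \<exists>j\<in>{Suc m'..Suc m'+n'}.
        \<epsilon> \<le> V (k + j) (trajectory \<phi> k s z j)} =
      (\<integral>\<^sup>+ y. emeasure S {z \<in> space S. \<exists>j\<in>{Suc m'..Suc m'+n'}.
        \<epsilon> \<le> V (k + j) (trajectory \<phi> k s (case_nat y z) j)} \<partial>D)"
      by (rule emeasure_first_step) measurable
    also have "\<dots> = (\<integral>\<^sup>+ y. emeasure S (?E m' n' (Suc k) (\<phi> k s y)) \<partial>D)"
      by (simp only: shift)
    finally have "ennreal \<epsilon> * emeasure S {z \<in> space S. \<exists>j\<in>{Suc m'..Suc m'+n'}.
        \<epsilon> \<le> V (k + j) (trajectory \<phi> k s z j)} =
      ennreal \<epsilon> * (\<integral>\<^sup>+ y. emeasure S (?E m' n' (Suc k) (\<phi> k s y)) \<partial>D)"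
      by simp
    also have "\<dots> = (\<integral>\<^sup>+ y. ennreal \<epsilon> * emeasure S (?E m' n' (Suc k) (\<phi> k s y)) \<partial>D)"
      by (rule nn_integral_cmult[symmetric]) (rule meas)
    also have "\<dots> \<le> (\<integral>\<^sup>+ y. ennreal p * ennreal (V (Suc k) (\<phi> k s y)) + ennreal (q + ?t) \<partial>D)"
    proof (rule nn_integral_mono_AE)
      show "AE y in D. ennreal \<epsilon> * emeasure S (?E m' n' (Suc k) (\<phi> k s y)) \<le>
          ennreal p * ennreal (V (Suc k) (\<phi> k s y)) + ennreal (q + ?t)"
        using G_step[OF Suc.prems(2)]
      proof eventually_elim
        case (elim y)
        have "ennreal \<epsilon> * emeasure S (?E m' n' (Suc k) (\<phi> k s y)) \<le>
          ennreal (mean_bound (Suc k) m' (V (Suc k) (\<phi> k s y)) + ?t)"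
          using Suc.prems(1) that by (intro Suc.hyps(1) elim) auto
        also have "\<dots> = ennreal (p * V (Suc k) (\<phi> k s y) + (q + ?t))"
          by (simp add: pq(3) add.assoc)
        also have "\<dots> = ennreal p * ennreal (V (Suc k) (\<phi> k s y)) + ennreal (q + ?t)"
          using pq t V_nonneg by (simp add: ennreal_mult)
        finally show ?case .
      qed
    qed
    also have "\<dots> = ennreal p * (\<integral>\<^sup>+ y. ennreal (V (Suc k) (\<phi> k s y)) \<partial>D) + ennreal (q + ?t)"
      by (simp add: nn_integral_add nn_integral_cmult M.emeasure_space_1)
    also have "\<dots> \<le> ennreal p * ennreal ((1 - a k) * V k s + b k) + ennreal (q + ?t)"
      by (intro add_mono mult_left_mono drift Suc.prems) auto
    also have "\<dots> = ennreal (mean_bound (Suc k) m' ((1 - a k) * V k s + b k) + ?t)"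
      using pq t a b V_nonneg by (simp add: ennreal_mult[symmetric] add.assoc flip: ennreal_plus)
    finally show ?thesis .
  qed
  show ?case
  proof (cases m)
    case (Suc m')
    with step[of m' n] Suc.hyps(2) show ?thesis by simp
  next
    case 0
    show ?thesis
    \<comment> \<open>The window starts now. Either \<open>V\<close> has reached the threshold and
      the bound is at least \<open>\<epsilon>\<close>, or time 0 can be removed from the window;
      then \<open>b k\<close> and the tail from \<open>Suc k\<close> recombine into the tail from
      \<open>k\<close>, and \<open>a k * V k s\<close> is dropped.\<close>
    proof (cases "\<epsilon> \<le> V k s")
      case True
      have "ennreal \<epsilon> * emeasure S (?E m n k s) \<le> ennreal \<epsilon> * 1"
        by (intro mult_left_mono P.measure_le_1) auto
      also have "\<dots> \<le> ennreal (V k s + (\<Sum>i. b (i + k)))"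
        using True tail_nonneg[of k] by (simp add: ennreal_leI)
      finally show ?thesis using 0 by simp
    next
      case False
      have "(\<exists>j\<in>{m..m+n}. \<epsilon> \<le> V (k + j) (trajectory \<phi> k s z j)) \<longleftrightarrow>
        (\<exists>j\<in>{Suc 0..Suc 0+r}. \<epsilon> \<le> V (k + j) (trajectory \<phi> k s z j))" for z
      proof -
        have "{m..m+n} = insert 0 {Suc 0..Suc 0+r}" using 0 Suc.hyps(2) by auto
        then show ?thesis using False by simp
      qed
      then have "ennreal \<epsilon> * emeasure S (?E m n k s) \<le>
          ennreal (((1 - a k) * V k s + b k) + (\<Sum>i. b (i + Suc k)))"
        using step[of 0 r] by simp
      also have "\<dots> \<le> ennreal (V k s + (\<Sum>i. b (i + k)))"
        using mult_nonneg_nonneg[OF a(1)[of k] V_nonneg[of k s]]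
        by (intro ennreal_leI) (simp add: tail_Suc[of k] algebra_simps)
      finally show ?thesis using 0 by simp
    qed
  qed
qed

text \<open>Windows starting at \<open>m\<close> of growing length bound the probability of reaching
  a threshold at or after step \<open>m\<close> by a multiple of \<open>mean_bound\<close> plus a
  tail, both tending to 0. So the threshold is reached infinitely often with probability 0;
  countably many thresholds give convergence.\<close>

lemma V_tendsto_0_from:
  assumes k: "K \<le> k" and G: "G k s"
  shows "AE z in S. (\<lambda>j. V (k + j) (trajectory \<phi> k s z j)) \<longlonglongrightarrow> 0"
proof -
  have s [measurable]: "s \<in> space N" using G G_space by blast
  let ?W = "\<lambda>z j. V (k + j) (trajectory \<phi> k s z j)"
  have ae: "AE z in S. \<exists>m. \<forall>j\<ge>m. ?W z j < \<epsilon>" if \<epsilon>: "0 < \<epsilon>" for \<epsilon> :: real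
  proof -
    define B where "B m = {z \<in> space S. \<exists>j\<ge>m. \<epsilon> \<le> ?W z j}" for m
    have B [measurable]: "B m \<in> sets S" for m unfolding B_def by measurable
    define c where "c m = mean_bound k m (V k s) + (\<Sum>i. b (i + (k + m)))" for m
    have cl: "c \<longlonglongrightarrow> 0"
    proof -
      have "(\<lambda>m. \<Sum>i. b (i + (k + m))) \<longlonglongrightarrow> 0"
        using LIMSEQ_ignore_initial_segment[OF suminf_exist_split2[OF b(2)], of k]
        by (simp add: add.commute)
      then show ?thesis
        unfolding c_def using tendsto_add[OF mean_bound_tendsto_0[OF V_nonneg]] by fastforce
    qed
    have bound: "ennreal \<epsilon> * emeasure S (B m) \<le> ennreal (c m)" for m
    proof -
      let ?C = "\<lambda>n. {z \<in> space S. \<exists>j\<in>{m..m+n}. \<epsilon> \<le> ?W z j}"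
      have "B m = (\<Union>n. ?C n)"
      proof (intro equalityI subsetI)
        fix z assume "z \<in> B m"
        then obtain j where "z \<in> space S" "m \<le> j" "\<epsilon> \<le> ?W z j"
          by (auto simp: B_def)
        then show "z \<in> (\<Union>n. ?C n)" by (intro UN_I[of "j - m"]) auto
      qed (auto simp: B_def)
      moreover have "(\<lambda>n. emeasure S (?C n)) \<longlonglongrightarrow> emeasure S (\<Union>n. ?C n)"
      proof (rule Lim_emeasure_incseq)
        show "range ?C \<subseteq> sets S" by auto
        show "incseq ?C"
          unfolding incseq_def by (auto intro!: bexI)
      qed
      ultimately have "(\<lambda>n. ennreal \<epsilon> * emeasure S (?C n)) \<longlonglongrightarrow> ennreal \<epsilon> * emeasure S (B m)"
        by (intro ennreal_tendsto_cmult) auto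
      then show ?thesis
        unfolding c_def using maximal_inequality[OF \<epsilon> k G] by (intro LIMSEQ_le_const2) auto
    qed
    have "emeasure S (\<Inter>m. B m) = 0"
    proof -
      have "ennreal \<epsilon> * emeasure S (\<Inter>m. B m) \<le> ennreal (c m)" for m
      proof -
        have "emeasure S (\<Inter>m. B m) \<le> emeasure S (B m)" by (intro emeasure_mono B) auto
        then show ?thesis using bound[of m] by (meson mult_left_mono order_trans zero_le)
      qed
      then have "ennreal \<epsilon> * emeasure S (\<Inter>m. B m) \<le> ennreal 0"
        using cl by (intro LIMSEQ_le_const[OF tendsto_ennrealI[OF cl]]) auto
      then show ?thesis using \<epsilon> by simp
    qed
    then have "AE z in S. z \<notin> (\<Inter>m. B m)"
      by (intro AE_not_in) (auto simp: null_sets_def)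
    then show ?thesis
      using AE_space by eventually_elim (auto simp: B_def, meson not_le)
  qed
  have "AE z in S. \<forall>i::nat. \<exists>m. \<forall>j\<ge>m. ?W z j < 1 / real (Suc i)"
    unfolding AE_all_countable using ae by auto
  then show ?thesis
  proof eventually_elim
    case (elim z)
    show ?case
    proof (rule LIMSEQ_I)
      fix r :: real assume "0 < r"
      then obtain i where "1 / real (Suc i) < r" using nat_approx_posE by blast
      moreover obtain m where "\<forall>j\<ge>m. ?W z j < 1 / real (Suc i)" using elim by blast
      ultimately show "\<exists>no. \<forall>n\<ge>no. norm (?W z n - 0) < r"
        using V_nonneg by (intro exI[of _ m]) (auto intro: less_trans)
    qed
  qed
qed

text \<open>Starts before \<open>K\<close> follow by induction on the distance to \<open>K\<close>:
  after one step, which almost surely stays in \<open>G\<close>, the claim holds for almost every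
  remaining sequence, and Fubini joins the two.\<close>

lemma V_tendsto_0:
  assumes "G k s"
  shows "AE z in S. (\<lambda>j. V (k + j) (trajectory \<phi> k s z j)) \<longlonglongrightarrow> 0"
  using assms
proof (induction "K - k" arbitrary: k s)
  case 0
  then show ?case by (intro V_tendsto_0_from) auto
next
  case (Suc r)
  interpret PS: pair_prob_space D S ..
  have s [measurable]: "s \<in> space N" using Suc.prems G_space by blast
  let ?conv = "\<lambda>k s z. (\<lambda>j. V (k + j) (trajectory \<phi> k s z j)) \<longlonglongrightarrow> 0"
  have shift: "?conv k s (case_nat y z) \<longleftrightarrow> ?conv (Suc k) (\<phi> k s y) z" for y z
    using filterlim_sequentially_Suc[of "\<lambda>j. V (k + j) (trajectory \<phi> k s (case_nat y z) j)" "nhds 0"]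
    by (simp add: trajectory_case_nat del: trajectory.simps)
  have "AE y in D. AE z in S. ?conv (Suc k) (\<phi> k s y) z"
    using G_step[OF Suc.prems] by eventually_elim (rule Suc.hyps(1), use Suc.hyps(2) in auto)
  then have "AE y in D. AE z in S. ?conv k s (case_nat y z)"
    by (simp add: shift)
  moreover have [measurable]: "(\<lambda>x. trajectory \<phi> k s (case_nat (fst x) (snd x)) j) \<in> D \<Otimes>\<^sub>M S \<rightarrow>\<^sub>M N" for j
    by (rule trajectory_measurable) simp_all
  ultimately have "AE x in D \<Otimes>\<^sub>M S. ?conv k s ((\<lambda>(y, z). case_nat y z) x)"
    by (intro PS.AE_pair_measure) (simp_all add: split_beta')
  then have "AE z in distr (D \<Otimes>\<^sub>M S) S (\<lambda>(y, z). case_nat y z). ?conv k s z"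
    by (subst AE_distr_iff) auto
  then show ?case unfolding PiM_iter .
qed

end

subsection \<open>Quasi-Newton matrices\<close>

lemma matrix_inv_invertible:
  fixes A :: "real ^ 'n ^ 'n"
  assumes "invertible A"
  shows "A *v (matrix_inv A *v v) = v"
proof -
  have "A ** matrix_inv A = mat 1 \<and> matrix_inv A ** A = mat 1"
    using assms unfolding invertible_def matrix_inv_def by (rule someI_ex)
  then show ?thesis by (simp add: matrix_vector_mul_assoc)
qed

text \<open>For singular \<open>A\<close> the predicate under the choice operator is constantly
  false, so the chosen matrix no longer depends on \<open>A\<close>.\<close>

lemma matrix_inv_not_invertible:
  fixes A :: "real ^ 'n ^ 'n"
  assumes "\<not> invertible A"
  shows "matrix_inv A = (SOME A'. False)"
  using assms unfolding invertible_def matrix_inv_def by metis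

lemma borel_measurable_det [measurable (raw)]:
  assumes "\<And>i j. (\<lambda>x. A x $ i $ j) \<in> borel_measurable M"
  shows "(\<lambda>x. det (A x :: real ^ 'n ^ 'n)) \<in> borel_measurable M"
  unfolding det_def using assms by measurable

lemma borel_measurable_vec_nth:
  fixes f :: "_ \<Rightarrow> 'a::{second_countable_topology, real_normed_vector} ^ 'n"
  assumes "f \<in> borel_measurable M"
  shows "(\<lambda>x. f x $ i) \<in> borel_measurable M"
  by (rule borel_measurable_continuous_on[OF _ assms]) (intro continuous_intros)

lemma borel_measurable_vecI:
  fixes f :: "_ \<Rightarrow> 'a::euclidean_space ^ 'n"
  assumes "\<And>i. (\<lambda>x. f x $ i) \<in> borel_measurable M"
  shows "f \<in> borel_measurable M"
  using assms by (auto simp: borel_measurable_euclidean_space[of f] Basis_vec_def inner_axis)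

lemma borel_measurable_matrix_vector_mult:
  fixes A :: "_ \<Rightarrow> real ^ 'n ^ 'm"
  assumes [measurable]: "A \<in> borel_measurable M" "v \<in> borel_measurable M"
  shows "(\<lambda>x. A x *v v x) \<in> borel_measurable M"
proof -
  note borel_measurable_vec_nth [measurable (raw)]
  show ?thesis
    by (rule borel_measurable_vecI) (simp add: matrix_vector_mult_def)
qed

lemma borel_measurable_matrix_matrix_mult:
  fixes A :: "_ \<Rightarrow> real ^ 'n ^ 'm" and C :: "_ \<Rightarrow> real ^ 'k ^ 'n"
  assumes [measurable]: "A \<in> borel_measurable M" "C \<in> borel_measurable M"
  shows "(\<lambda>x. A x ** C x) \<in> borel_measurable M"
proof -
  note borel_measurable_vec_nth [measurable (raw)]
  show ?thesis
    by (intro borel_measurable_vecI) (simp add: matrix_matrix_mult_def)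
qed

lemma borel_measurable_outer:
  assumes [measurable]: "u \<in> borel_measurable M" "v \<in> borel_measurable M"
  shows "(\<lambda>x. outer (u x) (v x)) \<in> borel_measurable M"
proof -
  note borel_measurable_vec_nth [measurable (raw)]
  show ?thesis
    by (intro borel_measurable_vecI)
       (simp add: outer_def columnvector_def rowvector_def matrix_matrix_mult_def)
qed

text \<open>Cramer's rule expresses the inverse through determinants; on singular matrices
  \<open>matrix_inv\<close> is a fixed unspecified matrix.\<close>

lemma borel_measurable_matrix_inv_mult:
  fixes A :: "_ \<Rightarrow> real ^ 'n ^ 'n"
  assumes [measurable]: "A \<in> borel_measurable M" "v \<in> borel_measurable M"
  shows "(\<lambda>x. matrix_inv (A x) *v v x) \<in> borel_measurable M"
proof -
  note borel_measurable_vec_nth [measurable (raw)] borel_measurable_matrix_vector_mult [measurable (raw)]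
  define c :: "real ^ 'n ^ 'n" where "c = (SOME A'. False)"
  define q where "q x = (\<chi> k. det (\<chi> i j. if j = k then v x $ i else A x $ i $ j) / det (A x))" for x
  have "matrix_inv (A x) *v v x = (if det (A x) = 0 then c *v v x else q x)" for x
  proof (cases "det (A x) = 0")
    case True
    then show ?thesis by (simp add: c_def matrix_inv_not_invertible invertible_det_nz)
  next
    case False
    then have "A x *v (matrix_inv (A x) *v v x) = v x"
      by (intro matrix_inv_invertible) (simp add: invertible_det_nz)
    with False show ?thesis by (simp add: cramer q_def)
  qed
  moreover have [measurable]: "q \<in> borel_measurable M"
    unfolding q_def
    by (intro borel_measurable_vecI, simp only: vec_lambda_beta)
       (intro borel_measurable_divide borel_measurable_det, simp_all)
  ultimately show ?thesis by simp
qed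

lemma borel_measurable_qn_update:
  assumes "A \<in> borel_measurable M" "s \<in> borel_measurable M" "y \<in> borel_measurable M"
  shows "(\<lambda>x. qn_update c (A x) (s x) (y x)) \<in> borel_measurable M"
  unfolding qn_update_def
  using assms by (intro borel_measurable_add borel_measurable_diff borel_measurable_scaleR borel_measurable_inner
      borel_measurable_divide borel_measurable_const borel_measurable_matrix_matrix_mult borel_measurable_outer
      borel_measurable_matrix_vector_mult)

section \<open>Lower bounds in the Loewner order\<close>

lemma loewner_ge_scaled_mat:
  "loewner_ge A (m *\<^sub>R mat 1) \<longleftrightarrow> transpose A = A \<and> (\<forall>v. m * (v \<bullet> v) \<le> v \<bullet> (A *v v))"
proof -
  have t: "transpose (A - m *\<^sub>R mat 1) = transpose A - m *\<^sub>R mat 1"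
    by (simp add: vec_eq_iff transpose_def mat_def)
  have m: "(m *\<^sub>R mat 1 :: real ^ 'n ^ 'n) *v v = m *\<^sub>R v" for v
    by (metis scaleR_matrix_vector_assoc matrix_vector_mul_lid)
  show ?thesis
    by (simp add: loewner_ge_def psd_def t matrix_vector_mult_diff_rdistrib m inner_diff_right)
qed

lemma outer_mult_vector: "outer u v *v w = (v \<bullet> w) *\<^sub>R u"
  by (simp add: vec_eq_iff outer_def columnvector_def rowvector_def matrix_matrix_mult_def
      matrix_vector_mult_def inner_vec_def sum_distrib_right sum_distrib_left mult_ac)

lemma transpose_outer: "transpose (outer u v) = outer v u"
  by (simp add: vec_eq_iff outer_def transpose_def columnvector_def rowvector_def
      matrix_matrix_mult_def mult_ac)

text \<open>Discriminant argument for the quadratic form on the span of \<open>v\<close> and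
  \<open>w\<close>, with a separate case because the form may vanish at \<open>w\<close>.\<close>

lemma psd_cauchy_schwarz:
  assumes "psd A"
  shows "(v \<bullet> (A *v w))\<^sup>2 \<le> (v \<bullet> (A *v v)) * (w \<bullet> (A *v w))"
proof -
  let ?a = "v \<bullet> (A *v v)" and ?b = "v \<bullet> (A *v w)" and ?c = "w \<bullet> (A *v w)"
  have sym: "w \<bullet> (A *v v) = ?b"
    using assms unfolding psd_def by (metis dot_lmul_matrix inner_commute transpose_matrix_vector)
  have nn: "0 \<le> u \<bullet> (A *v u)" for u
    using assms by (simp add: psd_def)
  have *: "0 \<le> r * r * ?a + 2 * (r * t) * ?b + t * t * ?c" for r t
    using nn[of "r *\<^sub>R v + t *\<^sub>R w"]
    by (simp add: matrix_vector_right_distrib matrix_vector_mult_scaleR inner_add_left inner_add_right sym algebra_simps)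
  show ?thesis
  proof (cases "?c = 0")
    case True
    have "?b = 0"
    proof (rule ccontr)
      assume "?b \<noteq> 0"
      \<comment> \<open>This choice of \<open>t\<close>, with \<open>r = 1\<close>, makes the form
        equal to -1.\<close>
      then show False
        using *[of 1 "- (?a + 1) / (2 * ?b)"] True by (simp add: field_simps)
    qed
    then show ?thesis using nn by simp
  next
    case False
    with nn[of w] have c: "0 < ?c" by simp
    have "0 \<le> ?c * (?a * ?c - ?b\<^sup>2)"
      using *[of ?c "- ?b"] by (simp add: algebra_simps power2_eq_square)
    with c have "0 \<le> ?a * ?c - ?b\<^sup>2" by (simp add: zero_le_mult_iff)
    then show ?thesis by simp
  qed
qed

text \<open>By Cauchy-Schwarz the subtracted rank-one term takes away at most the form of
  \<open>A\<close>, and the \<open>y\<close> term is nonnegative; \<open>c\<close> times the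
  identity remains. A vanishing denominator does no harm, as the quotient is then 0.\<close>

lemma loewner_ge_qn_update:
  assumes psd: "psd A" and sy: "0 \<le> s \<bullet> y"
  shows "loewner_ge (qn_update c A s y) (c *\<^sub>R mat 1)"
  unfolding loewner_ge_scaled_mat
proof (intro conjI allI)
  have At: "transpose A = A" using psd by (simp add: psd_def)
  have sym: "v \<bullet> (A *v w) = w \<bullet> (A *v v)" for v w
    by (metis At dot_lmul_matrix inner_commute transpose_matrix_vector)
  have tadd: "transpose (P + Q) = transpose P + transpose Q"
    and tdiff: "transpose (P - Q) = transpose P - transpose Q"
    and tscale: "transpose (r *\<^sub>R P) = r *\<^sub>R transpose P" for P Q :: "real ^ 'n ^ 'n" and r
    by (simp_all add: vec_eq_iff transpose_def)
  show "transpose (qn_update c A s y) = qn_update c A s y"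
    unfolding qn_update_def
    by (simp add: tadd tdiff tscale At transpose_outer matrix_transpose_mul matrix_mul_assoc)
  fix v
  let ?q = "s \<bullet> (A *v s)"
  have "(v \<bullet> (A *v s))\<^sup>2 / ?q \<le> v \<bullet> (A *v v)"
  proof (cases "?q = 0")
    case False
    moreover have "0 \<le> ?q" using psd by (simp add: psd_def)
    ultimately show ?thesis using psd_cauchy_schwarz[OF psd, of v s] by (simp add: field_simps)
  qed (use psd in \<open>simp add: psd_def\<close>)
  moreover have "0 \<le> (v \<bullet> y)\<^sup>2 / (s \<bullet> y)" using sy by simp
  moreover have "v \<bullet> (qn_update c A s y *v v) =
      v \<bullet> (A *v v) - (v \<bullet> (A *v s))\<^sup>2 / ?q + (v \<bullet> y)\<^sup>2 / (s \<bullet> y) + c * (v \<bullet> v)"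
    unfolding qn_update_def
    by (simp add: matrix_vector_mult_diff_rdistrib matrix_vector_mult_add_rdistrib outer_mult_vector
        inner_add_right inner_diff_right sym[of s v] power2_eq_square inner_commute[of y v]
        matrix_vector_mult_scaleR
        flip: scaleR_matrix_vector_assoc matrix_vector_mul_assoc)
  ultimately show "c * (v \<bullet> v) \<le> v \<bullet> (qn_update c A s y *v v)" by linarith
qed

text \<open>For \<open>w\<close> the image of \<open>v\<close> under the inverse, the lower bound on
  \<open>A\<close> bounds \<open>m\<close> times the squared norm of \<open>w\<close> by
  \<open>v \<bullet> w\<close>: this gives nonnegativity at once and the norm bound by
  Cauchy-Schwarz. It also makes the kernel of \<open>A\<close> trivial.\<close>

lemma
  fixes A :: "real ^ 'n ^ 'n"
  assumes m: "0 < m" and A: "loewner_ge A (m *\<^sub>R mat 1)"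
  shows norm_matrix_inv_le: "norm (matrix_inv A *v v) \<le> norm v / m"
    and inner_matrix_inv_nonneg: "0 \<le> v \<bullet> (matrix_inv A *v v)"
proof -
  have lower: "m * (w \<bullet> w) \<le> w \<bullet> (A *v w)" for w
    using A by (simp add: loewner_ge_scaled_mat)
  have "w = 0" if "A *v w = 0" for w
  proof -
    have "m * (w \<bullet> w) \<le> 0" using lower[of w] that by simp
    with m show ?thesis by (metis inner_gt_zero_iff mult_pos_pos not_le)
  qed
  then have "invertible A"
    by (metis invertible_left_inverse matrix_left_invertible_ker)
  then have *: "A *v (matrix_inv A *v v) = v" by (rule matrix_inv_invertible)
  let ?w = "matrix_inv A *v v"
  have **: "m * (norm ?w)\<^sup>2 \<le> v \<bullet> ?w"
    using lower[of ?w] unfolding * by (simp add: power2_norm_eq_inner inner_commute)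
  then show "0 \<le> v \<bullet> ?w"
    using m by (meson mult_nonneg_nonneg order_less_imp_le order_trans zero_le_power2)
  have "m * norm ?w * norm ?w \<le> norm v * norm ?w"
    using ** norm_cauchy_schwarz[of v ?w] by (simp add: power2_eq_square mult.assoc)
  then have "m * norm ?w \<le> norm v"
    by (cases "norm ?w = 0") (auto simp: mult_le_cancel_right)
  with m show "norm ?w \<le> norm v / m" by (simp add: field_simps)
qed

subsection \<open>Gradients\<close>

lemma has_real_derivative_along_line:
  fixes f :: "'a::euclidean_space \<Rightarrow> real"
  assumes "f differentiable (at (x + t *\<^sub>R d))"
  shows "((\<lambda>t. f (x + t *\<^sub>R d)) has_real_derivative d \<bullet> grad f (x + t *\<^sub>R d)) (at t)"
proof -
  have f: "(f has_derivative (\<lambda>h. h \<bullet> grad f (x + t *\<^sub>R d))) (at (x + t *\<^sub>R d))"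
    using GDERIV_grad[OF assms] by (simp add: gderiv_def)
  have "((\<lambda>t. x + t *\<^sub>R d) has_derivative (\<lambda>h. h *\<^sub>R d)) (at t)"
    by (auto intro!: derivative_eq_intros)
  from has_derivative_compose[OF this f] show ?thesis
    by (simp add: has_field_derivative_def mult_commute_abs)
qed

text \<open>Each coordinate is the limit of difference quotients with step
  \<open>1 / real (Suc n)\<close>, measurable since \<open>F\<close> is jointly measurable.\<close>

lemma borel_measurable_grad:
  fixes F :: "'a::euclidean_space \<Rightarrow> 'b::second_countable_topology \<Rightarrow> real"
  assumes F: "(\<lambda>(u, z). F u z) \<in> borel_measurable (borel \<Otimes>\<^sub>M borel)"
    and diff: "\<And>u z. (\<lambda>v. F v z) differentiable (at u)"
    and [measurable]: "g \<in> borel_measurable M" "h \<in> borel_measurable M"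
  shows "(\<lambda>x. grad (\<lambda>v. F v (h x)) (g x)) \<in> borel_measurable M"
proof -
  have F' [measurable (raw)]: "(\<lambda>x. F (g' x) (h' x)) \<in> borel_measurable M"
    if "g' \<in> borel_measurable M" "h' \<in> borel_measurable M" for g' h'
    using measurable_compose[OF measurable_Pair[OF that] F] by simp
  have "(\<lambda>x. grad (\<lambda>v. F v (h x)) (g x) \<bullet> i) \<in> borel_measurable M" for i
  proof (rule borel_measurable_LIMSEQ_real)
    let ?q = "\<lambda>n x. (F (g x + (1 / real (Suc n)) *\<^sub>R i) (h x) - F (g x) (h x)) / (1 / real (Suc n))"
    show "?q n \<in> borel_measurable M" for n by measurable
    fix x
    have "((\<lambda>t. F (g x + t *\<^sub>R i) (h x)) has_real_derivative i \<bullet> grad (\<lambda>v. F v (h x)) (g x + 0 *\<^sub>R i)) (at 0)"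
      by (rule has_real_derivative_along_line[OF diff])
    then have "((\<lambda>t. (F (g x + t *\<^sub>R i) (h x) - F (g x) (h x)) / t) \<longlongrightarrow> i \<bullet> grad (\<lambda>v. F v (h x)) (g x)) (at 0)"
      by (simp add: DERIV_def)
    moreover have "filterlim (\<lambda>n. 1 / real (Suc n)) (at 0) sequentially"
      using LIMSEQ_inverse_real_of_nat by (auto simp: filterlim_at inverse_eq_divide)
    ultimately show "(\<lambda>n. ?q n x) \<longlonglongrightarrow> grad (\<lambda>v. F v (h x)) (g x) \<bullet> i"
      by (auto dest: filterlim_compose simp: inner_commute)
  qed
  then show ?thesis by (auto simp: borel_measurable_euclidean_space[of "\<lambda>x. grad (\<lambda>v. F v (h x)) (g x)"])
qed

text \<open>Restriction to the line through \<open>x\<close> and \<open>y\<close> reduces this to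
  the one-dimensional tangent inequality between 0 and 1.\<close>

lemma convex_above_tangent:
  fixes f :: "'a::euclidean_space \<Rightarrow> real"
  assumes conv: "convex_on UNIV f" and diff: "f differentiable (at x)"
  shows "f x + (y - x) \<bullet> grad f x \<le> f y"
proof -
  let ?p = "\<lambda>t. f (x + t *\<^sub>R (y - x))"
  have "convex_on UNIV ?p"
  proof (rule convex_onI)
    fix t s r :: real assume "0 < t" "t < 1"
    moreover have "x + ((1 - t) *\<^sub>R s + t *\<^sub>R r) *\<^sub>R (y - x) =
        (1 - t) *\<^sub>R (x + s *\<^sub>R (y - x)) + t *\<^sub>R (x + r *\<^sub>R (y - x))"
      by (simp add: algebra_simps)
    ultimately show "?p ((1 - t) *\<^sub>R s + t *\<^sub>R r) \<le> (1 - t) * ?p s + t * ?p r"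
      using convex_onD[OF conv, of t "x + s *\<^sub>R (y - x)" "x + r *\<^sub>R (y - x)"] by simp
  qed simp
  moreover have "(?p has_real_derivative (y - x) \<bullet> grad f x) (at 0)"
    using has_real_derivative_along_line[of f x 0 "y - x"] diff by simp
  ultimately have "(y - x) \<bullet> grad f x * (1 - 0) \<le> ?p 1 - ?p 0"
    by (intro convex_on_imp_above_tangent[where A=UNIV]) auto
  then show ?thesis by simp
qed

lemma convex_grad_monotone:
  fixes f :: "'a::euclidean_space \<Rightarrow> real"
  assumes "convex_on UNIV f" "\<And>u. f differentiable (at u)"
  shows "0 \<le> (y - x) \<bullet> (grad f y - grad f x)"
  using convex_above_tangent[OF assms, of x y] convex_above_tangent[OF assms, of y x]
  by (simp add: inner_diff_left inner_diff_right)

text \<open>The descent lemma. \<open>?p\<close> is \<open>f\<close> along the segment minus the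
  linear and quadratic terms of the bound; the Lipschitz condition makes its derivative nonpositive,
  so comparing the ends suffices.\<close>

lemma lipschitz_grad_upper_bound:
  fixes f :: "'a::euclidean_space \<Rightarrow> real"
  assumes diff: "\<And>u. f differentiable (at u)" and lip: "L-lipschitz_on UNIV (grad f)"
  shows "f y \<le> f x + (y - x) \<bullet> grad f x + L / 2 * (norm (y - x))\<^sup>2"
proof -
  let ?d = "y - x"
  let ?p = "\<lambda>t. f (x + t *\<^sub>R ?d) - t * (?d \<bullet> grad f x) - L / 2 * t\<^sup>2 * (norm ?d)\<^sup>2"
  have "?p 1 \<le> ?p 0"
  proof (rule DERIV_nonpos_imp_nonincreasing[of 0 1])
    fix t :: real assume t: "0 \<le> t" "t \<le> 1"
    have "(?p has_real_derivative ?d \<bullet> grad f (x + t *\<^sub>R ?d) - ?d \<bullet> grad f x - L * t * (norm ?d)\<^sup>2) (at t)"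
      by (auto intro!: derivative_eq_intros has_real_derivative_along_line[OF diff])
    moreover have "?d \<bullet> grad f (x + t *\<^sub>R ?d) - ?d \<bullet> grad f x \<le> L * t * (norm ?d)\<^sup>2"
    proof -
      have "?d \<bullet> grad f (x + t *\<^sub>R ?d) - ?d \<bullet> grad f x \<le> norm ?d * norm (grad f (x + t *\<^sub>R ?d) - grad f x)"
        unfolding inner_diff_right[symmetric] by (rule norm_cauchy_schwarz)
      also have "\<dots> \<le> norm ?d * (L * norm (t *\<^sub>R ?d))"
        using lipschitz_on_normD[OF lip, of "x + t *\<^sub>R ?d" x] by (intro mult_left_mono) auto
      finally show ?thesis using t by (simp add: power2_eq_square mult_ac)
    qed
    ultimately show "\<exists>r. DERIV ?p t :> r \<and> r \<le> 0" by (meson diff_le_0_iff_le)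
  qed simp
  then show ?thesis by simp
qed

subsection \<open>One step on the regularized objective\<close>

lemma norm_square_expansion:
  fixes x y :: "'a::real_inner"
  shows "(norm y)\<^sup>2 = (norm x)\<^sup>2 + 2 * ((y - x) \<bullet> x) + (norm (y - x))\<^sup>2"
  by (simp add: power2_norm_eq_inner algebra_simps inner_commute)

text \<open>Polyak-Lojasiewicz inequality of the regularized objective with arbitrary comparison
  point \<open>u\<close>: the strong convexity bound times \<open>2 * m\<close> is a difference of
  two squares, and the subtracted one is discarded.\<close>

lemma regularized_gradient_domination:
  fixes f :: "'a::euclidean_space \<Rightarrow> real"
  assumes "convex_on UNIV f" "f differentiable (at x)" and m: "0 \<le> m"
  shows "2 * m * (f x + m / 2 * (norm x)\<^sup>2 - f u - m / 2 * (norm u)\<^sup>2) \<le> (norm (grad f x + m *\<^sub>R x))\<^sup>2"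
proof -
  let ?g = "grad f x + m *\<^sub>R x"
  let ?d = "u - x"
  have expand: "(norm (v + m *\<^sub>R d))\<^sup>2 = (norm v)\<^sup>2 + 2 * m * (d \<bullet> v) + m\<^sup>2 * (norm d)\<^sup>2" for v d :: 'a
    using norm_square_expansion[of "v + m *\<^sub>R d" v] by (simp add: power_mult_distrib)
  have f: "f x + ?d \<bullet> grad f x \<le> f u" by (rule convex_above_tangent[OF assms(1,2)])
  have "m / 2 * (norm u)\<^sup>2 = m / 2 * (norm x)\<^sup>2 + m * (?d \<bullet> x) + m / 2 * (norm ?d)\<^sup>2"
    unfolding norm_square_expansion[of u x] by (simp add: algebra_simps)
  moreover have "?d \<bullet> ?g = ?d \<bullet> grad f x + m * (?d \<bullet> x)"
    by (simp add: inner_add_right)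
  ultimately have "f x + m / 2 * (norm x)\<^sup>2 - f u - m / 2 * (norm u)\<^sup>2 \<le> - (?d \<bullet> ?g) - m / 2 * (norm ?d)\<^sup>2"
    using f by linarith
  then have "2 * m * (f x + m / 2 * (norm x)\<^sup>2 - f u - m / 2 * (norm u)\<^sup>2)
      \<le> 2 * m * (- (?d \<bullet> ?g) - m / 2 * (norm ?d)\<^sup>2)"
    using m by (intro mult_left_mono) auto
  also have "\<dots> = (norm ?g)\<^sup>2 - (norm (?g + m *\<^sub>R ?d))\<^sup>2"
    unfolding expand by (simp add: right_diff_distrib power2_eq_square)
  finally show ?thesis using zero_le_power2[of "norm (?g + m *\<^sub>R ?d)"] by linarith
qed

text \<open>Descent lemma with constant \<open>L + m\<close>, averaged over the sample.
  \<open>H\<close> does not depend on the sample, so unbiasedness of \<open>w\<close> turns the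
  linear term into \<open>- \<gamma> * (g \<bullet> H g)\<close>; the quadratic term splits into
  gradient and noise. The lower bound \<open>C\<close> makes the integrand nonnegative.\<close>

lemma (in prob_space) regularized_step_nn_integral:
  fixes f :: "'v::euclidean_space \<Rightarrow> real" and w :: "'a \<Rightarrow> 'v"
  assumes diff: "\<And>u. f differentiable (at u)"
    and L: "0 \<le> L" "L-lipschitz_on UNIV (grad f)"
    and w: "integrable M w" "(\<integral>\<omega>. w \<omega> \<partial>M) = grad f x"
    and var: "integrable M (\<lambda>\<omega>. (norm (w \<omega> - grad f x))\<^sup>2)"
      "(\<integral>\<omega>. (norm (w \<omega> - grad f x))\<^sup>2 \<partial>M) \<le> \<nu>\<^sup>2"
    and H: "bounded_linear H" "\<And>v. \<delta> * (norm v)\<^sup>2 \<le> v \<bullet> H v" "\<And>v. norm (H v) \<le> c * norm v"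
    and nonneg: "0 \<le> \<gamma>" "0 \<le> m"
    and C: "\<And>u. C \<le> f u"
  shows "(\<integral>\<^sup>+ \<omega>. ennreal (f (x - \<gamma> *\<^sub>R H (w \<omega> + m *\<^sub>R x)) - C
        + m / 2 * (norm (x - \<gamma> *\<^sub>R H (w \<omega> + m *\<^sub>R x)))\<^sup>2) \<partial>M)
    \<le> ennreal (f x - C + m / 2 * (norm x)\<^sup>2 - \<gamma> * \<delta> * (norm (grad f x + m *\<^sub>R x))\<^sup>2
        + (L + m) * (\<gamma> * c)\<^sup>2 * ((norm (grad f x + m *\<^sub>R x))\<^sup>2 + \<nu>\<^sup>2))"
proof -
  define g where "g = grad f x + m *\<^sub>R x"
  define Q where "Q = (L + m) * (\<gamma> * c)\<^sup>2"
  define e where "e u = f u - C + m / 2 * (norm u)\<^sup>2" for u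
  define X where "X \<omega> = x - \<gamma> *\<^sub>R H (w \<omega> + m *\<^sub>R x)" for \<omega>
  \<comment> \<open>An integrable majorant of the value after the step, through which the
    nonnegative integral is bounded by an ordinary mean.\<close>
  define R where "R \<omega> = e x - \<gamma> * (g \<bullet> H (w \<omega> + m *\<^sub>R x)) + Q * ((norm g)\<^sup>2 + (norm (w \<omega> - grad f x))\<^sup>2)" for \<omega>
  have Q0: "0 \<le> Q" using L nonneg by (simp add: Q_def)
  have e0: "0 \<le> e u" for u using C[of u] nonneg by (simp add: e_def)
  have eXR: "e (X \<omega>) \<le> R \<omega>" for \<omega>
  proof -
    let ?v = "w \<omega> + m *\<^sub>R x"
    have d: "X \<omega> - x = - (\<gamma> *\<^sub>R H ?v)" by (simp add: X_def)
    have "e (X \<omega>) \<le> e x + (X \<omega> - x) \<bullet> g + (L + m) / 2 * (norm (X \<omega> - x))\<^sup>2"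
      using lipschitz_grad_upper_bound[OF diff L(2), of "X \<omega>" x]
      unfolding e_def norm_square_expansion[of "X \<omega>" x] g_def
      by (simp add: inner_add_right field_simps)
    also have "(X \<omega> - x) \<bullet> g = - \<gamma> * (g \<bullet> H ?v)"
      by (simp add: d inner_commute)
    \<comment> \<open>Splitting the squared norm costs a factor 2, which cancels the 1/2 of the
      descent lemma.\<close>
    also have "(L + m) / 2 * (norm (X \<omega> - x))\<^sup>2 \<le> Q * ((norm g)\<^sup>2 + (norm (w \<omega> - grad f x))\<^sup>2)"
    proof -
      have "norm ?v \<le> norm g + norm (w \<omega> - grad f x)"
        using norm_triangle_ineq[of g "w \<omega> - grad f x"] by (simp add: g_def add.commute)
      then have "(norm ?v)\<^sup>2 \<le> (norm g + norm (w \<omega> - grad f x))\<^sup>2"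
        by (intro power_mono) auto
      also have "\<dots> \<le> 2 * ((norm g)\<^sup>2 + (norm (w \<omega> - grad f x))\<^sup>2)"
        using sum_squares_bound[of "norm g" "norm (w \<omega> - grad f x)"] by (simp add: power2_sum)
      finally have v: "(norm ?v)\<^sup>2 \<le> 2 * ((norm g)\<^sup>2 + (norm (w \<omega> - grad f x))\<^sup>2)" .
      have "norm (X \<omega> - x) \<le> \<gamma> * (c * norm ?v)"
        unfolding d using H(3)[of ?v] nonneg by (simp add: mult_left_mono)
      then have "(norm (X \<omega> - x))\<^sup>2 \<le> (\<gamma> * c)\<^sup>2 * (norm ?v)\<^sup>2"
        using power_mono[of "norm (X \<omega> - x)" "\<gamma> * (c * norm ?v)" 2]
        by (simp add: power_mult_distrib mult.assoc)
      then have "(L + m) / 2 * (norm (X \<omega> - x))\<^sup>2 \<le> (L + m) / 2 * ((\<gamma> * c)\<^sup>2 * (norm ?v)\<^sup>2)"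
        using L nonneg by (intro mult_left_mono) auto
      also have "\<dots> = Q / 2 * (norm ?v)\<^sup>2" by (simp add: Q_def)
      also have "\<dots> \<le> Q / 2 * (2 * ((norm g)\<^sup>2 + (norm (w \<omega> - grad f x))\<^sup>2))"
        using v Q0 by (intro mult_left_mono) auto
      finally show ?thesis by (simp add: algebra_simps)
    qed
    finally show ?thesis by (simp add: R_def)
  qed
  have bl: "bounded_linear (\<lambda>v. g \<bullet> H v)"
    by (rule bounded_linear_compose[OF bounded_linear_inner_right H(1)])
  have iv: "integrable M (\<lambda>\<omega>. w \<omega> + m *\<^sub>R x)" using w by simp
  have iH: "integrable M (\<lambda>\<omega>. g \<bullet> H (w \<omega> + m *\<^sub>R x))"
    by (rule integrable_bounded_linear[OF bl iv])
  have "(\<integral>\<omega>. g \<bullet> H (w \<omega> + m *\<^sub>R x) \<partial>M) = g \<bullet> H g"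
    using integral_bounded_linear[OF bl iv] w by (simp add: g_def prob_space)
  then have "(\<integral>\<omega>. R \<omega> \<partial>M) = e x - \<gamma> * (g \<bullet> H g)
      + Q * ((norm g)\<^sup>2 + (\<integral>\<omega>. (norm (w \<omega> - grad f x))\<^sup>2 \<partial>M))"
    unfolding R_def using iH var(1) by (simp add: prob_space)
  also have "\<dots> \<le> e x - \<gamma> * (\<delta> * (norm g)\<^sup>2) + Q * ((norm g)\<^sup>2 + \<nu>\<^sup>2)"
    using H(2)[of g] nonneg Q0 var(2) by (intro add_mono diff_mono mult_left_mono) auto
  finally have intR: "(\<integral>\<omega>. R \<omega> \<partial>M) \<le> e x - \<gamma> * (\<delta> * (norm g)\<^sup>2) + Q * ((norm g)\<^sup>2 + \<nu>\<^sup>2)" .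
  have iR: "integrable M R"
    unfolding R_def using iH var(1) by simp
  have "(\<integral>\<^sup>+ \<omega>. ennreal (e (X \<omega>)) \<partial>M) \<le> (\<integral>\<^sup>+ \<omega>. ennreal (R \<omega>) \<partial>M)"
    by (intro nn_integral_mono ennreal_leI eXR)
  also have "\<dots> = ennreal (\<integral>\<omega>. R \<omega> \<partial>M)"
    using order_trans[OF e0 eXR] by (intro nn_integral_eq_integral iR) auto
  also note ennreal_leI[OF intR]
  finally show ?thesis
    by (simp add: e_def X_def g_def Q_def mult.assoc)
qed

subsection \<open>The algorithm as a stochastic recursion\<close>

text \<open>The state includes the matrix because it carries the memory of earlier samples; its
  update uses the same sample as the move just made.\<close>

definition cr_sqn_step ::
  "(real ^ 'n \<Rightarrow> real ^ 'd \<Rightarrow> real) \<Rightarrow> (nat \<Rightarrow> real) \<Rightarrow> (nat \<Rightarrow> real) \<Rightarrow> (nat \<Rightarrow> real) \<Rightarrow> real \<Rightarrow> nat \<Rightarrow>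
   (real ^ 'n) \<times> (real ^ 'n ^ 'n) \<Rightarrow> real ^ 'd \<Rightarrow> (real ^ 'n) \<times> (real ^ 'n ^ 'n)" where
  "cr_sqn_step F \<gamma> \<delta> \<mu> \<rho> k s z =
    (let x = fst s; A = snd s;
         x' = x - \<gamma> k *\<^sub>R ((matrix_inv A + \<delta> k *\<^sub>R mat 1) *v (grad (\<lambda>u. F u z) x + \<mu> k *\<^sub>R x))
     in (x', if even k then qn_update (\<rho> * \<mu> k) A (x' - x) (qn_y F \<rho> (\<mu> k) z x x') else A))"

lemma cr_sqn_trajectory:
  assumes "cr_sqn F \<gamma> \<delta> \<mu> \<rho> B0 z x B"
  shows "trajectory (cr_sqn_step F \<gamma> \<delta> \<mu> \<rho>) 0 (x 0, B0) z k = (x k, B k)"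
proof (induction k)
  case 0
  show ?case using assms by (simp add: cr_sqn_def)
next
  case (Suc k)
  have "x (Suc k) = x k - \<gamma> k *\<^sub>R
      ((matrix_inv (B k) + \<delta> k *\<^sub>R mat 1) *v (grad (\<lambda>u. F u (z k)) (x k) + \<mu> k *\<^sub>R x k))"
    and "B (Suc k) = (if even k
      then qn_update (\<rho> * \<mu> k) (B k) (x (Suc k) - x k) (qn_y F \<rho> (\<mu> k) (z k) (x k) (x (Suc k)))
      else B k)"
    using assms unfolding cr_sqn_def by blast+
  with Suc.IH show ?case
    by (simp only: trajectory.simps cr_sqn_step_def Let_def fst_conv snd_conv add_0)
qed

lemma shifted_matrix_mult:
  fixes A :: "real ^ 'n ^ 'n"
  shows "(A + d *\<^sub>R mat 1) *v v = A *v v + d *\<^sub>R v"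
  by (simp add: matrix_vector_mult_add_rdistrib flip: scaleR_matrix_vector_assoc)

lemma borel_measurable_cr_sqn_step:
  fixes F :: "real ^ 'n \<Rightarrow> real ^ 'd \<Rightarrow> real"
  assumes F: "(\<lambda>(u, z). F u z) \<in> borel_measurable (borel \<Otimes>\<^sub>M borel)"
    and diff: "\<And>u z. (\<lambda>v. F v z) differentiable (at u)"
    and s: "s \<in> borel_measurable M" and y [measurable]: "y \<in> borel_measurable M"
  shows "(\<lambda>\<omega>. cr_sqn_step F \<gamma> \<delta> \<mu> \<rho> k (s \<omega>) (y \<omega>)) \<in> borel_measurable M"
proof -
  define x where "x \<omega> = fst (s \<omega>)" for \<omega>
  define A where "A \<omega> = snd (s \<omega>)" for \<omega>
  define v where "v \<omega> = grad (\<lambda>u. F u (y \<omega>)) (x \<omega>) + \<mu> k *\<^sub>R x \<omega>" for \<omega>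
  define x' where "x' \<omega> = x \<omega> - \<gamma> k *\<^sub>R (matrix_inv (A \<omega>) *v v \<omega> + \<delta> k *\<^sub>R v \<omega>)" for \<omega>
  have s': "s \<in> M \<rightarrow>\<^sub>M borel \<Otimes>\<^sub>M borel" using s by (simp add: borel_prod)
  have x: "x \<in> borel_measurable M" and A: "A \<in> borel_measurable M"
    unfolding x_def A_def
    using measurable_compose[OF s' measurable_fst] measurable_compose[OF s' measurable_snd] by simp_all
  have v: "v \<in> borel_measurable M"
    unfolding v_def
    by (intro borel_measurable_add borel_measurable_scaleR borel_measurable_const borel_measurable_grad[OF F diff] x y)
  have x': "x' \<in> borel_measurable M"
    unfolding x'_def
    by (intro borel_measurable_add borel_measurable_diff borel_measurable_scaleR borel_measurable_const
        borel_measurable_matrix_inv_mult x A v)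
  have q: "(\<lambda>\<omega>. qn_y F \<rho> (\<mu> k) (y \<omega>) (x \<omega>) (x' \<omega>)) \<in> borel_measurable M"
    unfolding qn_y_def
    by (intro borel_measurable_add borel_measurable_diff borel_measurable_scaleR borel_measurable_const
        borel_measurable_grad[OF F diff] x x' y)
  have "(\<lambda>\<omega>. if even k then qn_update (\<rho> * \<mu> k) (A \<omega>) (x' \<omega> - x \<omega>) (qn_y F \<rho> (\<mu> k) (y \<omega>) (x \<omega>) (x' \<omega>))
      else A \<omega>) \<in> borel_measurable M"
    using borel_measurable_qn_update[OF A borel_measurable_diff[OF x' x] q, of "\<rho> * \<mu> k"] A
    by (cases "even k") simp_all
  from borel_measurable_Pair[OF x' this] show ?thesis
    unfolding cr_sqn_step_def Let_def shifted_matrix_mult x'_def v_def x_def A_def .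
qed

text \<open>The lower bound is due to the shift \<open>d\<close> alone, as the inverse contributes a
  nonnegative term; the upper bound adds the two norms.\<close>

lemma regularized_inverse_bounds:
  fixes A :: "real ^ 'n ^ 'n"
  assumes m: "0 < m" and A: "loewner_ge A (m *\<^sub>R mat 1)" and d: "0 \<le> d"
  shows "d * (norm v)\<^sup>2 \<le> v \<bullet> ((matrix_inv A + d *\<^sub>R mat 1) *v v)"
    and "norm ((matrix_inv A + d *\<^sub>R mat 1) *v v) \<le> (1 / m + d) * norm v"
proof -
  show "d * (norm v)\<^sup>2 \<le> v \<bullet> ((matrix_inv A + d *\<^sub>R mat 1) *v v)"
    using inner_matrix_inv_nonneg[OF m A, of v]
    by (simp add: shifted_matrix_mult inner_add_right power2_norm_eq_inner)
  show "norm ((matrix_inv A + d *\<^sub>R mat 1) *v v) \<le> (1 / m + d) * norm v"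
    using norm_triangle_ineq[of "matrix_inv A *v v" "d *\<^sub>R v"] norm_matrix_inv_le[OF m A, of v] d
    by (simp add: shifted_matrix_mult distrib_right)
qed

text \<open>An even update produces the bound with \<open>\<rho> * \<mu> k\<close> afresh, since
  monotonicity of the gradient makes the curvature \<open>s \<bullet> y\<close> nonnegative; an odd
  step keeps the matrix. Since \<open>\<mu> (Suc k) \<le> \<mu> k\<close>, the bound for the next
  time follows.\<close>

lemma cr_sqn_step_loewner_ge:
  fixes F :: "real ^ 'n \<Rightarrow> real ^ 'd \<Rightarrow> real"
  assumes mono: "\<And>u v. 0 \<le> (v - u) \<bullet> (grad (\<lambda>v. F v z) v - grad (\<lambda>v. F v z) u)"
    and \<rho>: "0 < \<rho>" "\<rho> < 1" and \<mu>: "0 < \<mu> k" "\<mu> (Suc k) \<le> \<mu> k"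
    and A: "loewner_ge (snd s) ((\<rho> * \<mu> k) *\<^sub>R mat 1)"
  shows "loewner_ge (snd (cr_sqn_step F \<gamma> \<delta> \<mu> \<rho> k s z)) ((\<rho> * \<mu> (Suc k)) *\<^sub>R mat 1)"
proof -
  have weaken: "loewner_ge C ((\<rho> * \<mu> (Suc k)) *\<^sub>R mat 1)" if "loewner_ge C ((\<rho> * \<mu> k) *\<^sub>R mat 1)" for C :: "real ^ 'n ^ 'n"
    unfolding loewner_ge_scaled_mat
  proof (intro conjI allI)
    fix v :: "real ^ 'n"
    have "\<rho> * \<mu> (Suc k) * (v \<bullet> v) \<le> \<rho> * \<mu> k * (v \<bullet> v)"
      using \<rho> \<mu>(2) by (intro mult_right_mono mult_left_mono) auto
    also have "\<dots> \<le> v \<bullet> (C *v v)" using that by (simp add: loewner_ge_scaled_mat)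
    finally show "\<rho> * \<mu> (Suc k) * (v \<bullet> v) \<le> v \<bullet> (C *v v)" .
  qed (use that in \<open>simp add: loewner_ge_scaled_mat\<close>)
  have psd: "psd (snd s)"
    unfolding psd_def
  proof (intro conjI allI)
    fix v :: "real ^ 'n"
    have "0 \<le> \<rho> * \<mu> k * (v \<bullet> v)" using \<rho>(1) \<mu>(1) by simp
    also have "\<dots> \<le> v \<bullet> (snd s *v v)" using A by (simp add: loewner_ge_scaled_mat)
    finally show "0 \<le> v \<bullet> (snd s *v v)" .
  qed (use A in \<open>simp add: loewner_ge_scaled_mat\<close>)
  have "0 \<le> (x' - x) \<bullet> qn_y F \<rho> (\<mu> k) z x x'" for x x'
    using mono[of x' x] \<rho> \<mu>(1) by (simp add: qn_y_def inner_add_right)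
  then show ?thesis
    unfolding cr_sqn_step_def Let_def snd_conv
    by (cases "even k") (simp_all only: if_True if_False weaken loewner_ge_qn_update psd A)
qed

subsection \<open>Convergence\<close>

text \<open>Gives Borel measurability of the invariant, used to transfer it to the law of the
  sample; closedness survives the uncountable intersection over \<open>v\<close>.\<close>

lemma closed_loewner_ge: "closed {A. loewner_ge A (c *\<^sub>R mat 1 :: real ^ 'n ^ 'n)}"
proof -
  have "{A. loewner_ge A (c *\<^sub>R mat 1 :: real ^ 'n ^ 'n)} =
      {A. transpose A = A} \<inter> (\<Inter>v. {A. c * (v \<bullet> v) \<le> v \<bullet> (A *v v)})"
    by (auto simp: loewner_ge_scaled_mat)
  moreover have "closed {A :: real ^ 'n ^ 'n. transpose A = A}"
    unfolding transpose_def by (intro closed_Collect_eq continuous_intros)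
  moreover have "closed {A :: real ^ 'n ^ 'n. c * (v \<bullet> v) \<le> v \<bullet> (A *v v)}" for v
    unfolding matrix_vector_mult_def by (intro closed_Collect_le continuous_intros)
  ultimately show ?thesis by (simp add: closed_Int closed_INT)
qed

text \<open>\<open>indep_var\<close> relates only random variables with a common value type.\<close>

lemma (in prob_space) distr_pair_indep_set:
  assumes X: "X \<in> M \<rightarrow>\<^sub>M S" and Y: "Y \<in> M \<rightarrow>\<^sub>M T"
    and indep: "indep_set (sets (vimage_algebra (space M) X S)) (sets (vimage_algebra (space M) Y T))"
  shows "distr M (S \<Otimes>\<^sub>M T) (\<lambda>\<omega>. (X \<omega>, Y \<omega>)) = distr M S X \<Otimes>\<^sub>M distr M T Y"
proof -
  interpret X: prob_space "distr M S X" by (rule prob_space_distr[OF X])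
  interpret Y: prob_space "distr M T Y" by (rule prob_space_distr[OF Y])
  have "distr M S X \<Otimes>\<^sub>M distr M T Y = distr M (S \<Otimes>\<^sub>M T) (\<lambda>\<omega>. (X \<omega>, Y \<omega>))"
  proof (rule pair_measure_eqI)
    show "sets (distr M S X \<Otimes>\<^sub>M distr M T Y) = sets (distr M (S \<Otimes>\<^sub>M T) (\<lambda>\<omega>. (X \<omega>, Y \<omega>)))"
      unfolding sets_distr by (intro sets_pair_measure_cong) simp_all
    fix A B assume "A \<in> sets (distr M S X)" "B \<in> sets (distr M T Y)"
    then have AB: "A \<in> sets S" "B \<in> sets T" by simp_all
    have "prob ((X -` A \<inter> space M) \<inter> (Y -` B \<inter> space M)) = prob (X -` A \<inter> space M) * prob (Y -` B \<inter> space M)"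
      using indep AB by (auto simp: indep_sets2_eq in_vimage_algebra)
    moreover have "(\<lambda>\<omega>. (X \<omega>, Y \<omega>)) -` (A \<times> B) \<inter> space M = (X -` A \<inter> space M) \<inter> (Y -` B \<inter> space M)"
      by auto
    ultimately show "emeasure (distr M S X) A * emeasure (distr M T Y) B =
        emeasure (distr M (S \<Otimes>\<^sub>M T) (\<lambda>\<omega>. (X \<omega>, Y \<omega>))) (A \<times> B)"
      using AB X Y by (simp add: emeasure_distr emeasure_eq_measure ennreal_mult)
  qed unfold_locales
  then show ?thesis ..
qed

theorem theorem1:
  fixes M :: "'m measure"
    and F :: "real ^ 'n \<Rightarrow> real ^ 'd \<Rightarrow> real"
    and f :: "real ^ 'n \<Rightarrow> real"
    and \<xi> :: "'m \<Rightarrow> real ^ 'd"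
    and \<xi>s :: "nat \<Rightarrow> 'm \<Rightarrow> real ^ 'd"
    and x :: "nat \<Rightarrow> 'm \<Rightarrow> real ^ 'n"
    and B :: "nat \<Rightarrow> 'm \<Rightarrow> real ^ 'n ^ 'n"
    and B0 :: "real ^ 'n ^ 'n"
    and \<gamma> \<delta> \<mu> :: "nat \<Rightarrow> real"
    and \<rho> L \<nu> :: real
  assumes prob: "prob_space M"
    and xi_rv: "\<xi> \<in> borel_measurable M"
    and F_meas: "(\<lambda>(u, z). F u z) \<in> borel_measurable (borel \<Otimes>\<^sub>M borel)"
    and F_diff: "\<And>u z. (\<lambda>v. F v z) differentiable (at u)"
    and F_int: "\<And>u. integrable M (\<lambda>\<omega>. F u (\<xi> \<omega>))"
    and f_eq: "\<And>u. f u = (\<integral>\<omega>. F u (\<xi> \<omega>) \<partial>M)"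
    and \<gamma>_pos: "\<And>k. \<gamma> k > 0" and \<delta>_pos: "\<And>k. \<delta> k > 0" and \<mu>_pos: "\<And>k. \<mu> k > 0"
    and \<rho>: "0 < \<rho>" "\<rho> < 1"
    and B0_sym: "transpose B0 = B0"
    and B0_ge: "loewner_ge B0 ((\<rho> * \<mu> 0) *\<^sub>R mat 1)"
    and x0_rv: "x 0 \<in> borel_measurable M"
    and x0_indep: "prob_space.indep_set M
          (sets (vimage_algebra (space M) (x 0) borel))
          (sets (vimage_algebra (space M) (\<lambda>\<omega> k. \<xi>s k \<omega>) (Pi\<^sub>M UNIV (\<lambda>_. borel))))"
    and alg: "\<And>\<omega>. \<omega> \<in> space M \<Longrightarrow>
          cr_sqn F \<gamma> \<delta> \<mu> \<rho> B0 (\<lambda>k. \<xi>s k \<omega>) (\<lambda>k. x k \<omega>) (\<lambda>k. B k \<omega>)"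
    and standing: "AE \<omega> in M. \<forall>k. even k \<longrightarrow>
          grad (\<lambda>u. F u (\<xi>s k \<omega>)) (x k \<omega>) + \<mu> k *\<^sub>R x k \<omega> \<noteq> 0"
    and A1_convex: "\<And>\<omega>. \<omega> \<in> space M \<Longrightarrow> convex_on UNIV (\<lambda>u. F u (\<xi> \<omega>))"
    and A1_diff: "\<And>u. f differentiable (at u)"
    and A1_cont: "continuous_on UNIV (grad f)"
    and A1_L: "L > 0"
    and A1_lip: "L-lipschitz_on UNIV (grad f)"
    and A1_opt: "\<exists>u. \<forall>v. f u \<le> f v"
    and A2_indep: "prob_space.indep_vars M (\<lambda>_. borel) \<xi>s UNIV"
    and A2_law: "\<And>k. distr M borel (\<xi>s k) = distr M borel \<xi>"
    and A2_int: "\<And>u. integrable M (\<lambda>\<omega>. grad (\<lambda>v. F v (\<xi> \<omega>)) u)"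
    and A2_unbiased: "\<And>u. (\<integral>\<omega>. grad (\<lambda>v. F v (\<xi> \<omega>)) u \<partial>M) = grad f u"
    and A2_\<nu>: "\<nu> > 0"
    and A2_int2: "\<And>u. integrable M (\<lambda>\<omega>. (norm (grad (\<lambda>v. F v (\<xi> \<omega>)) u - grad f u))\<^sup>2)"
    and A2_var: "\<And>u. (\<integral>\<omega>. (norm (grad (\<lambda>v. F v (\<xi> \<omega>)) u - grad f u))\<^sup>2 \<partial>M) \<le> \<nu>\<^sup>2"
    and A3a: "(\<lambda>k. \<gamma> k / (\<mu> k ^ 3 * \<delta> k)) \<longlonglongrightarrow> 0"
    and A3b: "\<And>k. k \<ge> 1 \<Longrightarrow> \<delta> k * \<mu> (k - 1) \<le> 1"
    and A3c: "\<And>k. even k \<Longrightarrow> \<mu> (Suc k) = \<mu> k" "\<And>k. odd k \<Longrightarrow> \<mu> (Suc k) < \<mu> k"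
             "\<mu> \<longlonglongrightarrow> 0"
    and A3d: "filterlim (\<lambda>n. \<Sum>k<n. \<gamma> k * \<delta> k * \<mu> k) at_top sequentially"
    and A3e: "summable (\<lambda>k. (\<gamma> k / \<mu> k)\<^sup>2)"
    and A3f: "summable (\<lambda>k. \<gamma> k * \<delta> k * (\<mu> k)\<^sup>2)"
    and A3g: "\<And>k. \<gamma> k * \<delta> k * \<mu> k \<le> 1"
  shows "AE \<omega> in M. (\<lambda>k. f (x k \<omega>)) \<longlonglongrightarrow> (INF u. f u)"
proof -

  \<comment> \<open>Constants, Lyapunov function and invariant\<close>
  interpret prob_space M by (rule prob)
  define D where "D = distr M borel \<xi>"
  define S where "S = (\<Pi>\<^sub>M i\<in>(UNIV::nat set). D)"
  define step where "step = cr_sqn_step F \<gamma> \<delta> \<mu> \<rho>"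
  obtain u where u: "\<And>v. f u \<le> f v" using A1_opt by blast
  \<comment> \<open>Chosen so that
    \<open>1 / (\<rho> * \<mu> k) + \<delta> k \<le> C / \<mu> k\<close> whenever
    \<open>\<delta> k * \<mu> k \<le> 1\<close>; \<open>Q\<close> then bounds the second-order
    coefficient relative to \<open>(\<gamma> k / \<mu> k)\<^sup>2\<close>, uniformly in
    \<open>k\<close>.\<close>
  define C where "C = 1 / \<rho> + 1"
  define Q where "Q = (L + \<mu> 0) * C\<^sup>2"
  define G where "G k s = loewner_ge (snd s) ((\<rho> * \<mu> k) *\<^sub>R mat 1)" for k and s :: "(real ^ 'n) \<times> (real ^ 'n ^ 'n)"
  define V where "V k s = f (fst s) - f u + \<mu> k / 2 * (norm (fst s))\<^sup>2" for k and s :: "(real ^ 'n) \<times> (real ^ 'n ^ 'n)"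
  define a where "a k = \<gamma> k * \<delta> k * \<mu> k" for k
  \<comment> \<open>The first summand is the bias of the regularization at the minimizer
    \<open>u\<close>, the second the variance of the sampled gradient.\<close>
  define b where "b k = (norm u)\<^sup>2 * (\<gamma> k * \<delta> k * (\<mu> k)\<^sup>2) + (Q * \<nu>\<^sup>2) * (\<gamma> k / \<mu> k)\<^sup>2" for k

  interpret D: prob_space D unfolding D_def by (rule prob_space_distr) (rule xi_rv)
  have sets_D [measurable_cong]: "sets D = sets borel" by (simp add: D_def)
  have \<mu>_Suc: "\<mu> (Suc k) \<le> \<mu> k" for k using A3c(1,2)[of k] by (cases "even k") auto
  have \<mu>_0: "\<mu> k \<le> \<mu> 0" for k by (induction k) (auto intro: order_trans[OF \<mu>_Suc])
  have \<rho>\<mu>: "0 < \<rho> * \<mu> k" for k using \<rho> \<mu>_pos by simp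
  have Q0: "0 \<le> Q" using A1_L \<mu>_pos[of 0] by (simp add: Q_def)

  \<comment> \<open>Continuity and convexity of the objective\<close>
  have f_cont: "continuous_on UNIV f"
    using A1_diff by (intro continuous_at_imp_continuous_on) (auto intro: differentiable_imp_continuous_within)
  have f_meas [measurable (raw)]: "(\<lambda>x. f (h x)) \<in> borel_measurable A" if "h \<in> borel_measurable A" for h and A :: "'z measure"
    by (rule borel_measurable_continuous_on[OF f_cont that])
  have f_conv: "convex_on UNIV f"
  proof (rule convex_onI)
    fix t x y assume t: "0 < (t::real)" "t < 1"
    have "f ((1 - t) *\<^sub>R x + t *\<^sub>R y) \<le> (\<integral>\<omega>. (1 - t) * F x (\<xi> \<omega>) + t * F y (\<xi> \<omega>) \<partial>M)"
      unfolding f_eq using t F_int A1_convex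
      by (intro integral_mono) (auto intro!: convex_onD)
    then show "f ((1 - t) *\<^sub>R x + t *\<^sub>R y) \<le> (1 - t) * f x + t * f y"
      unfolding f_eq using F_int by simp
  qed simp

  \<comment> \<open>Measurability and invariance of one step\<close>
  have step_meas: "(\<lambda>\<omega>. step k (s \<omega>) (y \<omega>)) \<in> borel_measurable A"
    if "s \<in> borel_measurable A" "y \<in> borel_measurable A" for s y k and A :: "'z measure"
    unfolding step_def by (rule borel_measurable_cr_sqn_step[OF F_meas F_diff that])
  have G_step: "AE z in D. G (Suc k) (step k s z)" if "G k s" for k s
  proof -
    have m: "(\<lambda>z. snd (step k s z)) \<in> borel_measurable borel"
      by (rule borel_measurable_continuous_on[OF _ step_meas]) (auto intro!: continuous_intros)
    have "{z. G (Suc k) (step k s z)} \<in> sets borel"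
      using measurable_sets[OF m borel_closed[OF closed_loewner_ge]] by (simp add: G_def vimage_def)
    \<comment> \<open>Convexity is given at the values \<open>\<xi> \<omega>\<close>, so invariance
      is shown on \<open>M\<close> and then moved to \<open>D\<close>.\<close>
    moreover have "AE \<omega> in M. G (Suc k) (step k s (\<xi> \<omega>))"
      unfolding G_def step_def using A1_convex that[unfolded G_def]
      by (intro AE_I2 cr_sqn_step_loewner_ge convex_grad_monotone F_diff \<rho> \<mu>_pos \<mu>_Suc) auto
    ultimately show ?thesis
      unfolding D_def using xi_rv by (subst AE_distr_iff) auto
  qed
  have V0: "0 \<le> V k s" for k s
    using u[of "fst s"] \<mu>_pos[of k] by (simp add: V_def)

  \<comment> \<open>The drift inequality\<close>
  have "eventually (\<lambda>k. \<gamma> k / (\<mu> k ^ 3 * \<delta> k) < 1 / (2 * (Q + 1) * \<mu> 0)) sequentially"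
    using Q0 \<mu>_pos[of 0] by (intro order_tendstoD(2)[OF A3a]) auto
  \<comment> \<open>\<open>\<mu> 0\<close> absorbs the surplus factor \<open>\<mu> k\<close> of the
    cubic condition, and \<open>Q + 1\<close> is positive as \<open>Q\<close> is nonnegative; the
    aim is \<open>q \<le> \<gamma> k * \<delta> k / 2\<close> below.\<close>
  then obtain K0 where K0: "\<And>k. K0 \<le> k \<Longrightarrow> \<gamma> k / (\<mu> k ^ 3 * \<delta> k) < 1 / (2 * (Q + 1) * \<mu> 0)"
    by (auto simp: eventually_sequentially)
  \<comment> \<open>The 1 makes \<open>k - 1\<close> a true predecessor, as the bound on
    \<open>\<delta> k * \<mu> (k - 1)\<close> requires.\<close>
  define K where "K = max 1 K0"

  have drift: "(\<integral>\<^sup>+ y. ennreal (V (Suc k) (step k s y)) \<partial>D) \<le> ennreal ((1 - a k) * V k s + b k)"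
    if k: "K \<le> k" and G: "G k s" for k s
  proof -
    define x where "x = fst s"
    define H where "H v = (matrix_inv (snd s) + \<delta> k *\<^sub>R mat 1) *v v" for v
    define w where "w \<omega> = grad (\<lambda>v. F v (\<xi> \<omega>)) x" for \<omega>
    define g where "g = grad f x + \<mu> k *\<^sub>R x"
    have fst_step: "fst (step k s y) = x - \<gamma> k *\<^sub>R H (grad (\<lambda>v. F v y) x + \<mu> k *\<^sub>R x)" for y
      by (simp add: step_def cr_sqn_step_def Let_def x_def H_def)
    have \<delta>\<mu>: "\<delta> k * \<mu> k \<le> 1"
    proof -
      have "\<mu> k \<le> \<mu> (k - 1)" using \<mu>_Suc[of "k - 1"] k by (simp add: K_def)
      then have "\<delta> k * \<mu> k \<le> \<delta> k * \<mu> (k - 1)" using \<delta>_pos[of k] by simp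
      also have "\<dots> \<le> 1" using A3b[of k] k by (simp add: K_def)
      finally show ?thesis .
    qed
    have "1 / (\<rho> * \<mu> k) + \<delta> k \<le> C / \<mu> k"
      using \<delta>\<mu> \<rho> \<mu>_pos[of k] by (simp add: C_def field_simps)
    then have Hle: "norm (H v) \<le> C / \<mu> k * norm v" for v
      unfolding H_def using regularized_inverse_bounds(2)[OF \<rho>\<mu> G[unfolded G_def], of "\<delta> k" v] \<delta>_pos[of k]
      by (meson mult_right_mono norm_ge_zero order_trans order_less_imp_le)
    have fst_meas: "(\<lambda>y. fst (step k s y)) \<in> borel_measurable borel"
      by (rule borel_measurable_continuous_on[OF _ step_meas]) (auto intro!: continuous_intros)
    have "(\<integral>\<^sup>+ y. ennreal (V (Suc k) (step k s y)) \<partial>D) =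
        (\<integral>\<^sup>+ \<omega>. ennreal (V (Suc k) (step k s (\<xi> \<omega>))) \<partial>M)"
      unfolding D_def V_def using xi_rv fst_meas by (subst nn_integral_distr) auto
    \<comment> \<open>The next value carries the weight \<open>\<mu> (Suc k)\<close>, which is at
      most \<open>\<mu> k\<close>; this permits a one-step estimate with fixed weight.\<close>
    also have "\<dots> \<le> (\<integral>\<^sup>+ \<omega>. ennreal (f (x - \<gamma> k *\<^sub>R H (w \<omega> + \<mu> k *\<^sub>R x)) - f u
        + \<mu> k / 2 * (norm (x - \<gamma> k *\<^sub>R H (w \<omega> + \<mu> k *\<^sub>R x)))\<^sup>2) \<partial>M)"
      unfolding V_def fst_step w_def using \<mu>_Suc[of k]
      by (intro nn_integral_mono ennreal_leI add_mono mult_right_mono) auto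
    also have "\<dots> \<le> ennreal (f x - f u + \<mu> k / 2 * (norm x)\<^sup>2 - \<gamma> k * \<delta> k * (norm g)\<^sup>2
        + (L + \<mu> k) * (\<gamma> k * (C / \<mu> k))\<^sup>2 * ((norm g)\<^sup>2 + \<nu>\<^sup>2))"
      unfolding g_def
    proof (rule regularized_step_nn_integral[OF A1_diff _ A1_lip])
      show "\<delta> k * (norm v)\<^sup>2 \<le> v \<bullet> H v" for v
        unfolding H_def using regularized_inverse_bounds(1)[OF \<rho>\<mu> G[unfolded G_def]] \<delta>_pos[of k] by simp
      show "bounded_linear H" unfolding H_def by (rule matrix_vector_mul_bounded_linear)
    qed (use A1_L A2_int A2_unbiased A2_int2 A2_var Hle \<gamma>_pos[of k] \<mu>_pos[of k] u in \<open>auto simp: w_def\<close>)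
    also have "\<dots> \<le> ennreal ((1 - a k) * V k s + b k)"
    proof (rule ennreal_leI)
      define q where "q = Q * (\<gamma> k / \<mu> k)\<^sup>2"
      have "(L + \<mu> k) * (\<gamma> k * (C / \<mu> k))\<^sup>2 \<le> (L + \<mu> 0) * (\<gamma> k * (C / \<mu> k))\<^sup>2"
        using \<mu>_0[of k] by (intro mult_right_mono) auto
      also have "\<dots> = q" by (simp add: q_def Q_def power_mult_distrib power_divide)
      finally have q: "(L + \<mu> k) * (\<gamma> k * (C / \<mu> k))\<^sup>2 \<le> q" .
      have "q \<le> \<gamma> k * \<delta> k / 2"
      proof -
        have "2 * (Q + 1) * \<mu> 0 * \<gamma> k < \<mu> k ^ 3 * \<delta> k"
        proof -
          have "0 < \<mu> k ^ 3 * \<delta> k" "0 < 2 * (Q + 1) * \<mu> 0"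
            using Q0 \<mu>_pos[of 0] \<mu>_pos[of k] \<delta>_pos[of k] by auto
          with K0[of k] k show ?thesis by (simp add: K_def divide_less_eq less_divide_eq mult_ac)
        qed
        moreover have "2 * Q * \<mu> k * \<gamma> k \<le> 2 * (Q + 1) * \<mu> 0 * \<gamma> k"
          using Q0 \<mu>_0[of k] \<mu>_pos[of k] \<gamma>_pos[of k] by (intro mult_mono) auto
        ultimately have "\<mu> k * (2 * Q * \<gamma> k) \<le> \<mu> k * ((\<mu> k)\<^sup>2 * \<delta> k)"
          by (simp add: power2_eq_square power3_eq_cube mult_ac)
        then have "2 * Q * \<gamma> k \<le> (\<mu> k)\<^sup>2 * \<delta> k" using \<mu>_pos[of k] by simp
        then have "\<gamma> k * (2 * Q * \<gamma> k) \<le> \<gamma> k * ((\<mu> k)\<^sup>2 * \<delta> k)"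
          using \<gamma>_pos[of k] by (intro mult_left_mono) auto
        then show ?thesis
          using \<mu>_pos[of k] by (simp add: q_def power_divide field_simps power2_eq_square)
      qed
      \<comment> \<open>Half of the descent
        \<open>\<gamma> k * \<delta> k * (norm g)\<^sup>2\<close> pays for the gradient part of the
        second-order term. Through gradient domination the other half yields the contraction
        \<open>a k * V k s\<close>, up to the regularization bias.\<close>
      then have "q * (norm g)\<^sup>2 \<le> \<gamma> k * \<delta> k / 2 * (norm g)\<^sup>2"
        by (intro mult_right_mono) auto
      then have qg: "q * (norm g)\<^sup>2 \<le> \<gamma> k * \<delta> k * (norm g)\<^sup>2 / 2" by simp
      have Vx: "V k s = f x - f u + \<mu> k / 2 * (norm x)\<^sup>2"
        by (simp add: V_def x_def)
      have "2 * \<mu> k * (V k s - \<mu> k / 2 * (norm u)\<^sup>2) \<le> (norm g)\<^sup>2"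
        using regularized_gradient_domination[OF f_conv A1_diff, of "\<mu> k" x u] \<mu>_pos[of k]
        by (simp add: Vx g_def algebra_simps)
      then have "\<gamma> k * \<delta> k / 2 * (2 * \<mu> k * (V k s - \<mu> k / 2 * (norm u)\<^sup>2)) \<le> \<gamma> k * \<delta> k / 2 * (norm g)\<^sup>2"
        using \<gamma>_pos[of k] \<delta>_pos[of k] by (intro mult_left_mono) auto
      then have gd: "a k * V k s - (norm u)\<^sup>2 * (\<gamma> k * \<delta> k * (\<mu> k)\<^sup>2) / 2 \<le> \<gamma> k * \<delta> k * (norm g)\<^sup>2 / 2"
        by (simp add: a_def algebra_simps power2_eq_square)
      have "(L + \<mu> k) * (\<gamma> k * (C / \<mu> k))\<^sup>2 * ((norm g)\<^sup>2 + \<nu>\<^sup>2) \<le> q * ((norm g)\<^sup>2 + \<nu>\<^sup>2)"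
        using q by (intro mult_right_mono) auto
      also have "\<dots> = q * (norm g)\<^sup>2 + q * \<nu>\<^sup>2" by (rule distrib_left)
      finally have noise: "(L + \<mu> k) * (\<gamma> k * (C / \<mu> k))\<^sup>2 * ((norm g)\<^sup>2 + \<nu>\<^sup>2) \<le> q * (norm g)\<^sup>2 + q * \<nu>\<^sup>2" .
      have "0 \<le> (norm u)\<^sup>2 * (\<gamma> k * \<delta> k * (\<mu> k)\<^sup>2)"
        using \<gamma>_pos[of k] \<delta>_pos[of k] by simp
      moreover have "b k = (norm u)\<^sup>2 * (\<gamma> k * \<delta> k * (\<mu> k)\<^sup>2) + q * \<nu>\<^sup>2"
        by (simp add: b_def q_def mult_ac)
      moreover have "(1 - a k) * V k s = V k s - a k * V k s"
        by (simp add: left_diff_distrib)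
      ultimately show "f x - f u + \<mu> k / 2 * (norm x)\<^sup>2 - \<gamma> k * \<delta> k * (norm g)\<^sup>2
          + (L + \<mu> k) * (\<gamma> k * (C / \<mu> k))\<^sup>2 * ((norm g)\<^sup>2 + \<nu>\<^sup>2) \<le> (1 - a k) * V k s + b k"
        unfolding Vx[symmetric] using qg gd noise by linarith
    qed
    finally show ?thesis .
  qed

  \<comment> \<open>Application of the abstract recursion\<close>
  interpret R: drift_recursion D borel step G V a b K
  proof (intro drift_recursion.intro stochastic_recursion.intro sequence_space.intro
      product_prob_spaceI stochastic_recursion_axioms.intro drift_recursion_axioms.intro)
    show "prob_space D" by (rule D.prob_space_axioms)
    show "(\<lambda>(s, y). step k s y) \<in> borel \<Otimes>\<^sub>M D \<rightarrow>\<^sub>M borel" for k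
      unfolding split_beta' by (rule step_meas) measurable
    show "V k \<in> borel_measurable borel" for k
    proof -
      have [measurable]: "(fst :: (real ^ 'n) \<times> (real ^ 'n ^ 'n) \<Rightarrow> _) \<in> borel_measurable borel"
        by (intro borel_measurable_continuous_onI continuous_intros)
      show ?thesis unfolding V_def by measurable
    qed
    show "\<not> summable a"
    proof
      assume "summable a"
      then have "(\<lambda>n. \<Sum>k<n. a k) \<longlonglongrightarrow> suminf a" by (rule summable_LIMSEQ)
      then show False
        using A3d not_tendsto_and_filterlim_at_infinity[of sequentially "\<lambda>n. \<Sum>k<n. a k"]
        by (auto simp: a_def intro: filterlim_at_top_imp_at_infinity)
    qed
    show "summable b" unfolding b_def
      by (intro summable_add summable_mult A3e A3f)
    show "0 \<le> b k" "0 \<le> a k" "a k \<le> 1" for k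
      using \<gamma>_pos[of k] \<delta>_pos[of k] \<mu>_pos[of k] Q0 A3g[of k] by (simp_all add: b_def a_def)
  qed (use G_step V0 drift in auto)

  \<comment> \<open>From deterministic to random starting points\<close>
  define conv where "conv p \<longleftrightarrow> (\<lambda>j. V j (trajectory step 0 (fst p, B0) (snd p) j)) \<longlonglongrightarrow> 0"
    for p :: "(real ^ 'n) \<times> (nat \<Rightarrow> real ^ 'd)"
  \<comment> \<open>The invariant constrains only the matrix, so the bound on \<open>B0\<close>
    admits every deterministic starting point \<open>v\<close>.\<close>
  have conv_seq: "AE z in S. conv (v, z)" for v
    unfolding S_def conv_def using R.V_tendsto_0[of 0 "(v, B0)"] B0_ge by (simp add: G_def)

  define P0 where "P0 = distr M borel (x 0)"
  interpret P0: prob_space P0 unfolding P0_def by (rule prob_space_distr) (rule x0_rv)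
  interpret S: prob_space S unfolding S_def by (rule R.P.prob_space_axioms)
  interpret PS: pair_prob_space P0 S ..
  have xis_rv: "\<xi>s k \<in> borel_measurable M" for k
    using A2_indep by (auto simp: indep_vars_def)
  let ?BS = "\<Pi>\<^sub>M i\<in>(UNIV::nat set). (borel :: (real ^ 'd) measure)"
  let ?xis = "\<lambda>\<omega> k. \<xi>s k \<omega>"
  have sets_S [measurable_cong]: "sets S = sets ?BS" unfolding S_def by (intro sets_PiM_cong refl sets_D)
  have seq_rv: "?xis \<in> M \<rightarrow>\<^sub>M ?BS"
    using measurable_restrict[of UNIV \<xi>s M "\<lambda>_. borel"] xis_rv by (simp add: restrict_UNIV)
  have distr_seq: "distr M ?BS ?xis = S"
    using A2_indep indep_vars_iff_distr_eq_PiM[of UNIV \<xi>s "\<lambda>_. borel"] xis_rv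
    by (simp add: A2_law S_def D_def restrict_UNIV)
  \<comment> \<open>Independence of the start and the whole noise sequence makes their joint law a
    product, so the slicewise null sets combine into one.\<close>
  have joint: "distr M (borel \<Otimes>\<^sub>M ?BS) (\<lambda>\<omega>. (x 0 \<omega>, ?xis \<omega>)) = P0 \<Otimes>\<^sub>M S"
    using distr_pair_indep_set[OF x0_rv seq_rv x0_indep] by (simp add: distr_seq P0_def)
  have conv_meas: "Measurable.pred (borel \<Otimes>\<^sub>M S) conv"
  proof -
    have [measurable]: "(\<lambda>p. trajectory step 0 (fst p, B0) (snd p) j) \<in> borel_measurable (borel \<Otimes>\<^sub>M S)" for j
      unfolding S_def by (rule R.trajectory_measurable) (auto intro!: borel_measurable_Pair)
    show ?thesis unfolding conv_def by measurable
  qed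
  have "AE p in P0 \<Otimes>\<^sub>M S. conv p"
  proof (rule PS.AE_pair_measure)
    have "sets (P0 \<Otimes>\<^sub>M S) = sets (borel \<Otimes>\<^sub>M S)"
      by (intro sets_pair_measure_cong) (auto simp: P0_def)
    from conv_meas[folded measurable_cong_sets[OF this refl]] show "{p \<in> space (P0 \<Otimes>\<^sub>M S). conv p} \<in> sets (P0 \<Otimes>\<^sub>M S)"
      by (simp only: pred_def)
    show "AE v in P0. AE z in S. conv (v, z)" using conv_seq by simp
  qed
  then have "AE p in distr M (borel \<Otimes>\<^sub>M ?BS) (\<lambda>\<omega>. (x 0 \<omega>, ?xis \<omega>)). conv p"
    by (simp only: joint)
  then have "AE \<omega> in M. conv (x 0 \<omega>, ?xis \<omega>)"
  proof (subst (asm) AE_distr_iff)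
    show "(\<lambda>\<omega>. (x 0 \<omega>, ?xis \<omega>)) \<in> M \<rightarrow>\<^sub>M borel \<Otimes>\<^sub>M ?BS" using x0_rv seq_rv by simp
    have "sets (borel \<Otimes>\<^sub>M ?BS) = sets ((borel :: (real ^ 'n) measure) \<Otimes>\<^sub>M S)"
      by (intro sets_pair_measure_cong) (auto simp: sets_S)
    from conv_meas[folded measurable_cong_sets[OF this refl]] show "{p \<in> space (borel \<Otimes>\<^sub>M ?BS). conv p} \<in> sets (borel \<Otimes>\<^sub>M ?BS)"
      by (simp only: pred_def)
  qed

  \<comment> \<open>Return to the objective values\<close>
  then show ?thesis
    using AE_space
  proof eventually_elim
    case (elim \<omega>)
    have "(\<lambda>j. V j (x j \<omega>, B j \<omega>)) \<longlonglongrightarrow> 0"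
      using elim(1) cr_sqn_trajectory[OF alg[OF elim(2)]] by (simp add: conv_def step_def)
    then have "(\<lambda>j. f (x j \<omega>) - f u) \<longlonglongrightarrow> 0"
    \<comment> \<open>The optimality gap lies between 0 and \<open>V\<close>, as the regularization
      term is nonnegative.\<close>
    proof (rule tendsto_sandwich[OF _ _ tendsto_const, rotated -1])
      show "\<forall>\<^sub>F j in sequentially. 0 \<le> f (x j \<omega>) - f u" using u by simp
      show "\<forall>\<^sub>F j in sequentially. f (x j \<omega>) - f u \<le> V j (x j \<omega>, B j \<omega>)"
        using \<mu>_pos by (simp add: V_def less_imp_le)
    qed
    moreover have "(INF u. f u) = f u"
      using u by (intro cInf_eq_minimum) auto
    ultimately show ?case by (simp add: LIM_zero_iff)
  qed
qed

end
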